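(* Let $\mathfrak g,f_i,\Gamma^i,q_i,\mathfrak h,\mathfrak m_i,\chi_i,\widehat I_i$ ($i=1,2$) be as in the context. Assume: (1) there is a direct sum decomposition $\mathfrak m_2=\mathfrak m_1\oplus\mathfrak m_0$, where $\mathfrak m_0$ is an $\mathfrak h$-stable Lie subalgebra of $\mathfrak m_2$ and $\mathfrak m_1$ is an ideal of $\mathfrak m_2$; (2) the nilpotent element $f_0:=f_2-f_1$ and the Lie algebra $\mathfrak m_0$ are contained in $\mathfrak g^{(1)}_0$; (3) the semisimple element $q_0:=q_2-q_1$ commutes with $f_1$. Let $\widehat I_0$ be the left ideal of $\mathcal U(\mathfrak g,f_1)$ generated by the elements $(y-\chi_2(y))\bmod\widehat I_1$, $y\in\mathfrak m_0$, and let $\mathcal U_0:=\bigl(\mathcal U(\mathfrak g,f_1)/\widehat I_0\bigr)^{\operatorname{ad}(\mathfrak m_0)}$ be the quantum Hamiltonian reduction of $\mathcal U(\mathfrak g,f_1)$. Then the map $$\widehat\Psi:\mathcal U_0\to\mathcal U(\mathfrak g,f_2),\qquad (X\bmod\widehat I_1)\bmod\widehat I_0\mapsto X\bmod\widehat I_2,$$ is an algebra isomorphism.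
   Context: The ground field is $\mathbb C$. $\mathfrak g$ is a finite-dimensional simple Lie algebra, $(\cdot\mid\cdot)$ a nondegenerate invariant symmetric bilinear form on $\mathfrak g$, and $\Phi:\mathfrak g\to\mathfrak g^*$, $x\mapsto(x\mid\cdot)$. Good gradings. For nilpotent $f\in\mathfrak g$, a good grading for $f$ is a $\mathbb Z$-grading $\Gamma:\mathfrak g=\bigoplus_j\mathfrak g_j$ with $[\mathfrak g_i,\mathfrak g_j]\subset\mathfrak g_{i+j}$, $f\in\mathfrak g_{-2}$, and $\operatorname{ad}(f):\mathfrak g_j\to\mathfrak g_{j-2}$ injective for $j\ge1$ and surjective for $j\le1$. There is a semisimple $q_\Gamma\in\mathfrak g$ with $\mathfrak g_j=\{x:[q_\Gamma,x]=jx\}$. Put $\chi=\Phi(f)$. The form $\chi([\cdot,\cdot])$ is symplectic on $\mathfrak g_1$; choosing a Lagrangian subspace $\mathfrak l\subset\mathfrak g_1$, the associated good algebra is the nilpotent Lie subalgebra $\mathfrak m=\mathfrak l\oplus\bigoplus_{i\ge2}\mathfrak g_i$; $\chi|_{\mathfrak m}$ is a character of $\mathfrak m$. Finite W-algebra. Let $\widehat I$ be the left ideal of the enveloping algebra $\mathcal U(\mathfrak g)$ generated by $y-\chi(y)$, $y\in\mathfrak m$. The adjoint action of $\mathfrak m$ descends to $\mathcal U(\mathfrak g)/\widehat I$, and $\mathcal U(\mathfrak g,f):=(\mathcal U(\mathfrak g)/\widehat I)^{\operatorname{ad}(\mathfrak m)}$ is an associative algebra with product $(X\bmod\widehat I)(Y\bmod\widehat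 I)=XY\bmod\widehat I$. Data. $f_1,f_2\in\mathfrak g$ are nilpotent; for $i=1,2$, $\Gamma^i:\mathfrak g=\bigoplus_j\mathfrak g^{(i)}_j$ is a good grading for $f_i$ with semisimple element $q_i$, where $q_1,q_2$ lie in a common Cartan subalgebra $\mathfrak h$; $\chi_i=\Phi(f_i)$; $\mathfrak m_i$ is a good algebra for $(f_i,\Gamma^i)$ (some choice of Lagrangian subspace of $\mathfrak g^{(i)}_1$), $\widehat I_i$ the corresponding left ideal, and $\mathcal U(\mathfrak g,f_i)=(\mathcal U(\mathfrak g)/\widehat I_i)^{\operatorname{ad}(\mathfrak m_i)}$. Second stage. Under the hypotheses, $y\mapsto y\bmod\widehat I_1$ is a Lie algebra embedding $\mathfrak m_0\hookrightarrow\mathcal U(\mathfrak g,f_1)$. The adjoint action of $\mathfrak m_0$ on $\mathcal U(\mathfrak g,f_1)$ (commutator with $y\bmod\widehat I_1$) descends to $\mathcal U(\mathfrak g,f_1)/\widehat I_0$, and the invariants $\mathcal U_0$ form an algebra with product induced from $\mathcal U(\mathfrak g,f_1)$. *)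

theory Defs
  imports Complex_Main "HOL-Library.Poly_Mapping" "HOL-Algebra.Algebraic_Closure_Type"
    "HOL-Algebra.Module" "HOL-Algebra.QuotRing"
begin

section \<open>Complex Lie algebras\<close>

class complex_vector = ab_group_add +
  fixes scaleC :: "complex \<Rightarrow> 'a \<Rightarrow> 'a"  (infixr \<open>*\<^sub>C\<close> 75)
  assumes scaleC_add_right: "c *\<^sub>C (x + y) = c *\<^sub>C x + c *\<^sub>C y"
    and scaleC_add_left: "(c + d) *\<^sub>C x = c *\<^sub>C x + d *\<^sub>C x"
    and scaleC_scaleC: "c *\<^sub>C (d *\<^sub>C x) = (c * d) *\<^sub>C x"
    and scaleC_one: "1 *\<^sub>C x = x"

global_interpretation complex_vector: vector_space "scaleC :: complex \<Rightarrow> 'a \<Rightarrow> 'a::complex_vector"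
  by standard (simp_all add: scaleC_add_right scaleC_add_left scaleC_scaleC scaleC_one)

class complex_lie_algebra = complex_vector +
  fixes bracket :: "'a \<Rightarrow> 'a \<Rightarrow> 'a"
  assumes bracket_add_left: "bracket (x + y) z = bracket x z + bracket y z"
    and bracket_add_right: "bracket x (y + z) = bracket x y + bracket x z"
    and bracket_scale_left: "bracket (c *\<^sub>C x) y = c *\<^sub>C bracket x y"
    and bracket_scale_right: "bracket x (c *\<^sub>C y) = c *\<^sub>C bracket x y"
    and bracket_self: "bracket x x = 0"
    and jacobi: "bracket x (bracket y z) + bracket y (bracket z x) + bracket z (bracket x y) = 0"

definition finite_dimensional :: "'g::complex_vector itself \<Rightarrow> bool" where
  "finite_dimensional _ \<longleftrightarrow> (\<exists>B :: 'g set. finite B \<and> complex_vector.span B = UNIV)"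

definition lie_subalgebra :: "'g::complex_lie_algebra set \<Rightarrow> bool" where
  "lie_subalgebra a \<longleftrightarrow>
     complex_vector.subspace a \<and> (\<forall>x\<in>a. \<forall>y\<in>a. bracket x y \<in> a)"

definition lie_ideal_in :: "'g::complex_lie_algebra set \<Rightarrow> 'g set \<Rightarrow> bool" where
  "lie_ideal_in a b \<longleftrightarrow>
     complex_vector.subspace a \<and> a \<subseteq> b \<and> (\<forall>x\<in>b. \<forall>y\<in>a. bracket x y \<in> a)"

definition simple_lie_algebra :: "'g::complex_lie_algebra itself \<Rightarrow> bool" where
  "simple_lie_algebra _ \<longleftrightarrow>
     (\<exists>x y :: 'g. bracket x y \<noteq> 0) \<and>
     (\<forall>a :: 'g set. lie_ideal_in a UNIV \<longrightarrow> a = {0} \<or> a = UNIV)"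

fun lower_central :: "'g::complex_lie_algebra set \<Rightarrow> nat \<Rightarrow> 'g set" where
  "lower_central a 0 = a"
| "lower_central a (Suc n) =
     complex_vector.span {bracket x y | x y. x \<in> a \<and> y \<in> lower_central a n}"

definition lie_normalizer :: "'g::complex_lie_algebra set \<Rightarrow> 'g set" where
  "lie_normalizer a = {x. \<forall>y\<in>a. bracket x y \<in> a}"

definition cartan_subalgebra :: "'g::complex_lie_algebra set \<Rightarrow> bool" where
  "cartan_subalgebra h \<longleftrightarrow>
     lie_subalgebra h \<and> (\<exists>n. lower_central h n = {0}) \<and> lie_normalizer h = h"

definition nilpotent_element :: "'g::complex_lie_algebra \<Rightarrow> bool" where
  "nilpotent_element x \<longleftrightarrow> (\<exists>n. \<forall>z. (bracket x ^^ n) z = 0)"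

text \<open>Over the complex numbers, semisimplicity of \<open>ad x\<close> is diagonalizability.\<close>

definition semisimple_element :: "'g::complex_lie_algebra \<Rightarrow> bool" where
  "semisimple_element x \<longleftrightarrow>
     complex_vector.span {z. \<exists>c. bracket x z = c *\<^sub>C z} = UNIV"

definition invariant_form :: "('g::complex_lie_algebra \<Rightarrow> 'g \<Rightarrow> complex) \<Rightarrow> bool" where
  "invariant_form \<beta> \<longleftrightarrow>
     (\<forall>x y z. \<beta> (x + y) z = \<beta> x z + \<beta> y z) \<and>
     (\<forall>c x y. \<beta> (c *\<^sub>C x) y = c * \<beta> x y) \<and>
     (\<forall>x y. \<beta> x y = \<beta> y x) \<and>
     (\<forall>x y z. \<beta> (bracket x y) z = \<beta> x (bracket y z)) \<and>
     (\<forall>x. (\<forall>y. \<beta> x y = 0) \<longrightarrow> x = 0)"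


section \<open>Good gradings and good algebras\<close>

definition lie_grading :: "(int \<Rightarrow> 'g::complex_lie_algebra set) \<Rightarrow> bool" where
  "lie_grading \<Gamma> \<longleftrightarrow>
     (\<forall>j. complex_vector.subspace (\<Gamma> j)) \<and>
     (\<forall>x. \<exists>!v. (\<forall>j. v j \<in> \<Gamma> j) \<and> finite {j. v j \<noteq> 0} \<and> x = (\<Sum>j | v j \<noteq> 0. v j)) \<and>
     (\<forall>i j. \<forall>x\<in>\<Gamma> i. \<forall>y\<in>\<Gamma> j. bracket x y \<in> \<Gamma> (i + j))"

definition good_grading :: "'g::complex_lie_algebra \<Rightarrow> (int \<Rightarrow> 'g set) \<Rightarrow> bool" where
  "good_grading f \<Gamma> \<longleftrightarrow>
     lie_grading \<Gamma> \<and> f \<in> \<Gamma> (-2) \<and>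
     (\<forall>j\<ge>1. inj_on (bracket f) (\<Gamma> j)) \<and>
     (\<forall>j\<le>1. bracket f ` \<Gamma> j = \<Gamma> (j - 2))"

definition grading_element :: "'g::complex_lie_algebra \<Rightarrow> (int \<Rightarrow> 'g set) \<Rightarrow> bool" where
  "grading_element q \<Gamma> \<longleftrightarrow>
     semisimple_element q \<and> (\<forall>j. \<Gamma> j = {x. bracket q x = of_int j *\<^sub>C x})"

text \<open>For an invariant form \<open>\<beta>\<close>, the partial application \<open>\<beta> f\<close> is the linear form \<open>\<chi> = \<Phi>(f)\<close>.
  The symplectic form on \<open>V = \<Gamma> 1\<close> is \<open>\<chi>([x, y])\<close>, and a Lagrangian subspace is one equal to
  its own orthogonal in \<open>V\<close>.\<close>

definition lagrangian ::
  "('g::complex_lie_algebra \<Rightarrow> complex) \<Rightarrow> 'g set \<Rightarrow> 'g set \<Rightarrow> bool" where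
  "lagrangian \<chi> V l \<longleftrightarrow>
     complex_vector.subspace l \<and> l = {x \<in> V. \<forall>y\<in>l. \<chi> (bracket x y) = 0}"

definition good_algebra ::
  "('g::complex_lie_algebra \<Rightarrow> 'g \<Rightarrow> complex) \<Rightarrow> 'g \<Rightarrow> (int \<Rightarrow> 'g set) \<Rightarrow> 'g set \<Rightarrow> bool" where
  "good_algebra \<beta> f \<Gamma> m \<longleftrightarrow>
     (\<exists>l. lagrangian (\<beta> f) (\<Gamma> 1) l \<and> m = complex_vector.span (l \<union> (\<Union>i\<in>{2..}. \<Gamma> i)))"


section \<open>The universal enveloping algebra\<close>

text \<open>\<open>'g word \<Rightarrow>\<^sub>0 complex\<close> is the free associative unital algebra on the underlying set of
  \<open>'g\<close>.  Dividing it by the linear relations gives the tensor algebra, and the relations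
  \<open>xy - yx = [x, y]\<close> then give the enveloping algebra; both are imposed at once.\<close>

datatype 'g word = Word "'g list"

instantiation word :: (type) monoid_add
begin

definition zero_word :: "'a word" where "zero_word = Word []"

fun plus_word :: "'a word \<Rightarrow> 'a word \<Rightarrow> 'a word" where
  "plus_word (Word u) (Word v) = Word (u @ v)"

instance
proof
  fix a b c :: "'a word"
  show "a + b + c = a + (b + c)" by (cases a; cases b; cases c) simp
  show "0 + a = a" by (cases a) (simp add: zero_word_def)
  show "a + 0 = a" by (cases a) (simp add: zero_word_def)
qed

end

type_synonym 'g free_alg = "'g word \<Rightarrow>\<^sub>0 complex"

definition free_gen :: "'g \<Rightarrow> 'g free_alg" where
  "free_gen x = Poly_Mapping.single (Word [x]) 1"

definition free_const :: "complex \<Rightarrow> 'g free_alg" where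
  "free_const c = Poly_Mapping.single 0 c"

inductive uea_eq :: "'g::complex_lie_algebra free_alg \<Rightarrow> 'g free_alg \<Rightarrow> bool" where
  refl: "uea_eq a a"
| sym: "uea_eq a b \<Longrightarrow> uea_eq b a"
| trans: "uea_eq a b \<Longrightarrow> uea_eq b c \<Longrightarrow> uea_eq a c"
| add: "uea_eq a a' \<Longrightarrow> uea_eq b b' \<Longrightarrow> uea_eq (a + b) (a' + b')"
| mult: "uea_eq a a' \<Longrightarrow> uea_eq b b' \<Longrightarrow> uea_eq (a * b) (a' * b')"
| gen_add: "uea_eq (free_gen (x + y)) (free_gen x + free_gen y)"
| gen_scale: "uea_eq (free_gen (c *\<^sub>C x)) (free_const c * free_gen x)"
| gen_bracket: "uea_eq (free_gen (bracket x y))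
    (free_gen x * free_gen y - free_gen y * free_gen x)"

lemma word_zero_eq_plus_iff: "0 = u + v \<longleftrightarrow> u = 0 \<and> v = 0" for u v :: "'g word"
  by (cases u; cases v) (auto simp: zero_word_def)

lemma lookup_times_zero:
  "Poly_Mapping.lookup (a * b) 0 = Poly_Mapping.lookup a 0 * Poly_Mapping.lookup b 0"
  for a b :: "'g free_alg"
proof -
  have "(\<Sum>q. Poly_Mapping.lookup b q when (0 :: 'g word) = l + q) =
      (Poly_Mapping.lookup b 0 when l = 0)" for l
    by (cases "l = 0") (simp_all add: word_zero_eq_plus_iff when_def)
  then show ?thesis
    by (simp add: lookup_mult mult_when)
qed

lemma lookup_free_gen_zero: "Poly_Mapping.lookup (free_gen x) 0 = 0"
  by (simp add: free_gen_def lookup_single zero_word_def)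

lemma uea_eq_lookup_zero:
  "uea_eq a b \<Longrightarrow> Poly_Mapping.lookup a 0 = Poly_Mapping.lookup b 0"
  by (induction rule: uea_eq.induct)
    (simp_all add: lookup_add lookup_minus lookup_times_zero lookup_free_gen_zero)

lemma not_uea_eq_0_1: "\<not> uea_eq 0 1"
  by (auto dest!: uea_eq_lookup_zero)

lemma free_const_add: "free_const (c + d) = free_const c + free_const d"
  by (simp add: free_const_def single_add)

lemma free_const_mult: "free_const (c * d) = free_const c * free_const d"
  by (simp add: free_const_def mult_single)

lemma free_const_one: "free_const 1 = 1"
  by (simp add: free_const_def)

lemma free_const_central: "free_const c * a = a * free_const c"
proof (induction a rule: update_induct)
  case const
  show ?case by simp
next
  case (update f a b)
  have "Poly_Mapping.update a b f = Poly_Mapping.single a b + f"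
    using update(1)
    by (intro poly_mapping_eqI) (auto simp: lookup_update lookup_add lookup_single in_keys_iff)
  then show ?case
    using update(3)
    by (simp add: free_const_def mult_single mult.commute distrib_left distrib_right)
qed

quotient_type (overloaded) 'g uea = "'g::complex_lie_algebra free_alg" / uea_eq
  by (rule equivpI; (rule reflpI sympI transpI)) (auto intro: uea_eq.intros)

lemma uea_eq_uminus: "uea_eq (- a) (- b)" if "uea_eq a b"
  using uea_eq.mult[OF uea_eq.refl[of "- 1"] that] by simp

instantiation uea :: (complex_lie_algebra) ring_1
begin

lift_definition zero_uea :: "'a uea" is 0 .
lift_definition one_uea :: "'a uea" is 1 .
lift_definition plus_uea :: "'a uea \<Rightarrow> 'a uea \<Rightarrow> 'a uea" is "(+)" by (rule uea_eq.add)
lift_definition uminus_uea :: "'a uea \<Rightarrow> 'a uea" is uminus by (rule uea_eq_uminus)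
lift_definition times_uea :: "'a uea \<Rightarrow> 'a uea \<Rightarrow> 'a uea" is "(*)" by (rule uea_eq.mult)
lift_definition minus_uea :: "'a uea \<Rightarrow> 'a uea \<Rightarrow> 'a uea" is "(-)"
  using uea_eq.add uea_eq_uminus by fastforce

instance
proof
  fix a b c :: "'a uea"
  show "a + b + c = a + (b + c)" by transfer (simp add: add.assoc uea_eq.refl)
  show "a + b = b + a" by transfer (simp add: add.commute uea_eq.refl)
  show "0 + a = a" by transfer (simp add: uea_eq.refl)
  show "- a + a = 0" by transfer (simp add: uea_eq.refl)
  show "a - b = a + - b" by transfer (simp add: uea_eq.refl)
  show "a * b * c = a * (b * c)" by transfer (simp add: mult.assoc uea_eq.refl)
  show "1 * a = a" by transfer (simp add: uea_eq.refl)
  show "a * 1 = a" by transfer (simp add: uea_eq.refl)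
  show "(a + b) * c = a * c + b * c" by transfer (simp add: distrib_right uea_eq.refl)
  show "a * (b + c) = a * b + a * c" by transfer (simp add: distrib_left uea_eq.refl)
  show "(0 :: 'a uea) \<noteq> 1" by transfer (rule not_uea_eq_0_1)
qed

end

instantiation uea :: (complex_lie_algebra) complex_vector
begin

lift_definition scaleC_uea :: "complex \<Rightarrow> 'a uea \<Rightarrow> 'a uea" is "\<lambda>c a. free_const c * a"
  by (rule uea_eq.mult[OF uea_eq.refl])

instance
proof
  fix c d :: complex and x y :: "'a uea"
  show "c *\<^sub>C (x + y) = c *\<^sub>C x + c *\<^sub>C y" by transfer (simp add: distrib_left uea_eq.refl)
  show "(c + d) *\<^sub>C x = c *\<^sub>C x + d *\<^sub>C x"
    by transfer (simp add: free_const_add distrib_right uea_eq.refl)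
  show "c *\<^sub>C (d *\<^sub>C x) = (c * d) *\<^sub>C x"
    by transfer (simp add: free_const_mult mult.assoc uea_eq.refl)
  show "1 *\<^sub>C x = x" by transfer (simp add: free_const_one uea_eq.refl)
qed

end

lift_definition uea_incl :: "'g::complex_lie_algebra \<Rightarrow> 'g uea" is free_gen .

lemma uea_incl_add: "uea_incl (x + y) = uea_incl x + uea_incl y"
  by transfer (rule uea_eq.gen_add)

lemma uea_incl_scale: "uea_incl (c *\<^sub>C x) = c *\<^sub>C uea_incl x"
  by transfer (rule uea_eq.gen_scale)

lemma uea_incl_bracket:
  "uea_incl (bracket x y) = uea_incl x * uea_incl y - uea_incl y * uea_incl x"
  by transfer (rule uea_eq.gen_bracket)

lemma uea_scale_mult_left: "(c *\<^sub>C a) * b = c *\<^sub>C (a * b)" for a b :: "'g::complex_lie_algebra uea"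
  by transfer (simp add: mult.assoc uea_eq.refl)

lemma uea_scale_mult_right: "a * (c *\<^sub>C b) = c *\<^sub>C (a * b)" for a b :: "'g::complex_lie_algebra uea"
  by transfer (metis free_const_central mult.assoc uea_eq.refl)


section \<open>Associative algebras and quantum Hamiltonian reduction\<close>

text \<open>The library's locale \<open>algebra\<close> is for commutative algebras, so only its record type and
  the locale \<open>module\<close> are used here.\<close>

definition complex_algebra :: "(complex, 'a) module \<Rightarrow> bool" where
  "complex_algebra A \<longleftrightarrow>
     ring A \<and> module (ring_of_type_algebra :: complex ring) A \<and>
     (\<forall>c. \<forall>x\<in>carrier A. \<forall>y\<in>carrier A.
        (c \<odot>\<^bsub>A\<^esub> x) \<otimes>\<^bsub>A\<^esub> y = c \<odot>\<^bsub>A\<^esub> (x \<otimes>\<^bsub>A\<^esub> y) \<and>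
        x \<otimes>\<^bsub>A\<^esub> (c \<odot>\<^bsub>A\<^esub> y) = c \<odot>\<^bsub>A\<^esub> (x \<otimes>\<^bsub>A\<^esub> y))"

definition algebra_iso ::
  "(complex, 'a) module \<Rightarrow> (complex, 'b) module \<Rightarrow> ('a \<Rightarrow> 'b) set" where
  "algebra_iso A B =
     {h. complex_algebra A \<and> complex_algebra B \<and> h \<in> ring_iso A B \<and>
         (\<forall>c. \<forall>x\<in>carrier A. h (c \<odot>\<^bsub>A\<^esub> x) = c \<odot>\<^bsub>B\<^esub> h x)}"

definition left_ideal :: "'a set \<Rightarrow> ('a, 'm) ring_scheme \<Rightarrow> bool" where
  "left_ideal I R \<longleftrightarrow>
     additive_subgroup I R \<and> (\<forall>r\<in>carrier R. \<forall>x\<in>I. r \<otimes>\<^bsub>R\<^esub> x \<in> I)"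

definition gen_left_ideal :: "('a, 'm) ring_scheme \<Rightarrow> 'a set \<Rightarrow> 'a set" where
  "gen_left_ideal R S = \<Inter>{I. left_ideal I R \<and> S \<subseteq> I}"

text \<open>For an algebra \<open>R\<close>, a Lie algebra \<open>m\<close> mapped to \<open>R\<close> by \<open>\<iota>\<close>, and a character \<open>\<chi>\<close> of \<open>m\<close>,
  \<open>shift_ideal\<close> is the left ideal \<open>I\<close> generated by all \<open>\<iota> y - \<chi> y\<close>, and \<open>ham_reduction\<close> is
  the algebra of \<open>ad m\<close>-invariants in \<open>R/I\<close>.  Operations on cosets are, as for
  \<^const>\<open>rcoset_mult\<close>, unions over representatives; this is the usual induced operation
  whenever the latter is well defined (for the product: on invariants).\<close>

definition shift_ideal ::
  "(complex, 'a) module \<Rightarrow> ('g \<Rightarrow> 'a) \<Rightarrow> 'g set \<Rightarrow> ('g \<Rightarrow> complex) \<Rightarrow> 'a set" where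
  "shift_ideal R \<iota> m \<chi> = gen_left_ideal R ((\<lambda>y. \<iota> y \<ominus>\<^bsub>R\<^esub> (\<chi> y \<odot>\<^bsub>R\<^esub> \<one>\<^bsub>R\<^esub>)) ` m)"

definition rcoset_ad :: "('a, 'm) ring_scheme \<Rightarrow> 'a set \<Rightarrow> 'a \<Rightarrow> 'a set \<Rightarrow> 'a set" where
  "rcoset_ad R I a C = (\<Union>x\<in>C. I +>\<^bsub>R\<^esub> (a \<otimes>\<^bsub>R\<^esub> x \<ominus>\<^bsub>R\<^esub> x \<otimes>\<^bsub>R\<^esub> a))"

definition rcoset_smult :: "(complex, 'a) module \<Rightarrow> 'a set \<Rightarrow> complex \<Rightarrow> 'a set \<Rightarrow> 'a set" where
  "rcoset_smult R I c C = (\<Union>x\<in>C. I +>\<^bsub>R\<^esub> (c \<odot>\<^bsub>R\<^esub> x))"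

definition ham_reduction ::
  "(complex, 'a) module \<Rightarrow> ('g \<Rightarrow> 'a) \<Rightarrow> 'g set \<Rightarrow> ('g \<Rightarrow> complex) \<Rightarrow> (complex, 'a set) module" where
  "ham_reduction R \<iota> m \<chi> =
     (let I = shift_ideal R \<iota> m \<chi> in
      \<lparr>carrier = {C \<in> a_rcosets\<^bsub>R\<^esub> I. \<forall>y\<in>m. rcoset_ad R I (\<iota> y) C = I},
       monoid.mult = rcoset_mult R I, one = (I +>\<^bsub>R\<^esub> \<one>\<^bsub>R\<^esub>), ring.zero = I, add = set_add R,
       module.smult = rcoset_smult R I\<rparr>)"


section \<open>Finite W-algebras and reduction by stages\<close>

definition uea_algebra :: "(complex, 'g::complex_lie_algebra uea) module" where
  "uea_algebra = \<lparr>carrier = UNIV, monoid.mult = (*), one = 1, ring.zero = 0, add = (+), module.smult = (*\<^sub>C)\<rparr>"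

text \<open>The \<open>stage\<close> constants perform the second reduction: that of the algebra \<open>W_algebra \<beta> f\<^sub>1 m\<^sub>1\<close>
  by the image of \<open>m\<^sub>0\<close>, with the character \<open>\<beta> f\<^sub>2\<close> restricted to \<open>m\<^sub>0\<close>.\<close>

definition W_ideal ::
  "('g::complex_lie_algebra \<Rightarrow> 'g \<Rightarrow> complex) \<Rightarrow> 'g \<Rightarrow> 'g set \<Rightarrow> 'g uea set" where
  "W_ideal \<beta> f m = shift_ideal uea_algebra uea_incl m (\<beta> f)"

definition W_algebra ::
  "('g::complex_lie_algebra \<Rightarrow> 'g \<Rightarrow> complex) \<Rightarrow> 'g \<Rightarrow> 'g set \<Rightarrow> (complex, 'g uea set) module" where
  "W_algebra \<beta> f m = ham_reduction uea_algebra uea_incl m (\<beta> f)"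

definition W_class ::
  "('g::complex_lie_algebra \<Rightarrow> 'g \<Rightarrow> complex) \<Rightarrow> 'g \<Rightarrow> 'g set \<Rightarrow> 'g uea \<Rightarrow> 'g uea set" where
  "W_class \<beta> f m u = W_ideal \<beta> f m +>\<^bsub>uea_algebra\<^esub> u"

definition stage_ideal ::
  "('g::complex_lie_algebra \<Rightarrow> 'g \<Rightarrow> complex) \<Rightarrow> 'g \<Rightarrow> 'g set \<Rightarrow> 'g \<Rightarrow> 'g set \<Rightarrow> 'g uea set set" where
  "stage_ideal \<beta> f\<^sub>1 m\<^sub>1 f\<^sub>2 m\<^sub>0 =
     shift_ideal (W_algebra \<beta> f\<^sub>1 m\<^sub>1) (\<lambda>y. W_class \<beta> f\<^sub>1 m\<^sub>1 (uea_incl y)) m\<^sub>0 (\<beta> f\<^sub>2)"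

definition stage_algebra ::
  "('g::complex_lie_algebra \<Rightarrow> 'g \<Rightarrow> complex) \<Rightarrow> 'g \<Rightarrow> 'g set \<Rightarrow> 'g \<Rightarrow> 'g set \<Rightarrow>
     (complex, 'g uea set set) module" where
  "stage_algebra \<beta> f\<^sub>1 m\<^sub>1 f\<^sub>2 m\<^sub>0 =
     ham_reduction (W_algebra \<beta> f\<^sub>1 m\<^sub>1) (\<lambda>y. W_class \<beta> f\<^sub>1 m\<^sub>1 (uea_incl y)) m\<^sub>0 (\<beta> f\<^sub>2)"

definition stage_class ::
  "('g::complex_lie_algebra \<Rightarrow> 'g \<Rightarrow> complex) \<Rightarrow> 'g \<Rightarrow> 'g set \<Rightarrow> 'g \<Rightarrow> 'g set \<Rightarrow>
     'g uea set \<Rightarrow> 'g uea set set" where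
  "stage_class \<beta> f\<^sub>1 m\<^sub>1 f\<^sub>2 m\<^sub>0 A =
     stage_ideal \<beta> f\<^sub>1 m\<^sub>1 f\<^sub>2 m\<^sub>0 +>\<^bsub>W_algebra \<beta> f\<^sub>1 m\<^sub>1\<^esub> A"

end

theory Submission
  imports Defs
begin

text \<open>Let \<open>x i\<close> be a homogeneous basis of \<open>m\<^sub>1\<close>, and let \<open>u i\<close> be homogeneous elements of \<open>g\<close> dual to it
  for the pairing \<open>\<chi>\<^sub>1([x, u])\<close>.  Skryabin's argument shows that modulo a left ideal \<open>I\<close> the products
  of the shifted elements \<open>x i - \<chi>\<^sub>1(x i)\<close> act on ordered monomials in the \<open>u i\<close>, applied to Whittaker
  vectors, by a triangular array with nonzero scalars on its diagonal.  Hence the monomials are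
  independent over the Whittaker vectors of \<open>U/I\<close>, and for \<open>I = I\<^sub>1\<close>, where a Kazhdan filtration makes the
  \<open>m\<^sub>1\<close>-action locally nilpotent, they also span; no Poincare-Birkhoff-Witt theorem is needed.

  Surjectivity: expand a representative of an element of \<open>U(g, f\<^sub>2)\<close> in monomials over \<open>U(g, f\<^sub>1)\<close>.  Independence
  modulo \<open>I\<^sub>2\<close> leaves the constant term only.  Injectivity: the elements whose coefficients lie in \<open>I\<^sub>0\<close> form a
  left ideal containing \<open>I\<^sub>2\<close>, so independence modulo \<open>I\<^sub>1\<close> shows that an element of \<open>U(g, f\<^sub>1)\<close> which dies
  modulo \<open>I\<^sub>2\<close> lies in \<open>I\<^sub>0\<close>.\<close>

section \<open>Whittaker vectors and Skryabin's theorem\<close>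

lemma uea_scaleC_eq_mult: "c *\<^sub>C p = (c *\<^sub>C 1) * p" for p :: "'g::complex_lie_algebra uea"
  by (simp add: uea_scale_mult_left)

text \<open>For \<open>z\<close> in the nilpotent subalgebra these are the generators of the left
  ideal. The definition admits every \<open>z\<close>, because brackets outside the subalgebra are
  rewritten in the same form.\<close>

definition shifted :: "('g::complex_lie_algebra \<Rightarrow> complex) \<Rightarrow> 'g \<Rightarrow> 'g uea" where
  "shifted \<chi> z = uea_incl z - \<chi> z *\<^sub>C 1"

lemma uea_incl_zero: "uea_incl 0 = 0"
  using uea_incl_add[of 0 0] by simp

lemma uea_incl_eq_shifted: "uea_incl z * p = shifted \<chi> z * p + \<chi> z *\<^sub>C p"
  by (simp add: shifted_def algebra_simps uea_scale_mult_left)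

text \<open>Scalars are central, so the commutator is the bracket without a shift. Rewriting that
  bracket as a shifted element later releases the scalar \<chi>([z, y]); this is how the pairing of
  dual bases enters.\<close>

lemma shifted_commute_incl:
  "shifted \<chi> z * (uea_incl y * p) = uea_incl y * (shifted \<chi> z * p) + uea_incl (bracket z y) * p"
  by (simp add: shifted_def uea_incl_bracket algebra_simps uea_scale_mult_left uea_scale_mult_right)

text \<open>Words span the free algebra, and letters are stripped off a word from the left; the
  result is carried to the quotient through representatives.\<close>

lemma uea_induct_left:
  fixes p :: "'g::complex_lie_algebra uea"
  assumes const: "\<And>c. P (c *\<^sub>C 1)"
    and add: "\<And>p q. P p \<Longrightarrow> P q \<Longrightarrow> P (p + q)"
    and mult: "\<And>y p. P p \<Longrightarrow> P (uea_incl y * p)"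
  shows "P p"
proof -
  define Q :: "'g free_alg \<Rightarrow> bool" where "Q a \<longleftrightarrow> P (abs_uea a)" for a
  have Q_single: "Q (Poly_Mapping.single (Word w) c)" for w c
  proof (induction w)
    case Nil
    have "abs_uea (Poly_Mapping.single (Word []) c) = c *\<^sub>C (1 :: 'g uea)"
      by (simp add: one_uea.abs_eq scaleC_uea.abs_eq free_const_def zero_word_def)
    then show ?case by (simp add: Q_def const)
  next
    case (Cons y w)
    have "Poly_Mapping.single (Word (y # w)) c = free_gen y * Poly_Mapping.single (Word w) c"
      by (simp add: free_gen_def mult_single)
    then have "abs_uea (Poly_Mapping.single (Word (y # w)) c) =
        uea_incl y * abs_uea (Poly_Mapping.single (Word w) c)"
      by (simp add: uea_incl.abs_eq times_uea.abs_eq)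
    then show ?case using Cons mult by (simp add: Q_def)
  qed
  have "Q a" for a
  proof (induction a rule: update_induct)
    case const
    show ?case using assms(1)[of 0] by (simp add: Q_def zero_uea.abs_eq[symmetric])
  next
    case (update f a b)
    have "Poly_Mapping.update a b f = Poly_Mapping.single a b + f"
      using update(1)
      by (intro poly_mapping_eqI) (auto simp: lookup_update lookup_add lookup_single in_keys_iff)
    moreover have "Q (Poly_Mapping.single a b)"
      using Q_single by (cases a) simp
    ultimately show ?case
      using update(3) by (simp add: Q_def plus_uea.abs_eq[symmetric] add)
  qed
  then show ?thesis
    unfolding Q_def by (metis Quotient_uea Quotient_abs_rep)
qed

section \<open>Dual homogeneous bases and ordered monomials\<close>

locale dual_bases =
  fixes \<chi> :: "'g::complex_lie_algebra \<Rightarrow> complex" and \<Gamma> :: "int \<Rightarrow> 'g set"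
    and r :: nat and x u :: "nat \<Rightarrow> 'g" and d :: "nat \<Rightarrow> int"
  assumes span_\<Gamma>: "complex_vector.span (\<Union>j. \<Gamma> j) = UNIV"
    and subspace_\<Gamma>: "complex_vector.subspace (\<Gamma> k)"
    and bracket_\<Gamma>: "y \<in> \<Gamma> k \<Longrightarrow> z \<in> \<Gamma> l \<Longrightarrow> bracket y z \<in> \<Gamma> (k + l)"
    and \<chi>_add: "\<chi> (y + z) = \<chi> y + \<chi> z"
    and \<chi>_scale: "\<chi> (c *\<^sub>C y) = c * \<chi> y"
    and \<chi>_\<Gamma>: "y \<in> \<Gamma> k \<Longrightarrow> k \<noteq> 2 \<Longrightarrow> \<chi> y = 0"
    and x_\<Gamma>: "i < r \<Longrightarrow> x i \<in> \<Gamma> (d i)"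
    and u_\<Gamma>: "i < r \<Longrightarrow> u i \<in> \<Gamma> (2 - d i)"
    and d_pos: "i < r \<Longrightarrow> d i \<ge> 1"
    and d_antimono: "i \<le> j \<Longrightarrow> j < r \<Longrightarrow> d j \<le> d i"
    and dual: "i < r \<Longrightarrow> j < r \<Longrightarrow> \<chi> (bracket (x i) (u j)) = (if i = j then 1 else 0)"
    and \<Gamma>_span_x: "k \<ge> 2 \<Longrightarrow> \<Gamma> k \<subseteq> complex_vector.span {x i | i. i < r \<and> d i = k}"
    and \<chi>_bracket_x: "i < r \<Longrightarrow> j < r \<Longrightarrow> \<chi> (bracket (x i) (x j)) = 0"
begin

text \<open>For k at least 2 this is all of \<open>\<Gamma> k\<close>. In degree 1 it may be a
  proper subspace, such as a Lagrangian one.\<close>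

abbreviation layer :: "int \<Rightarrow> 'g set" where
  "layer k \<equiv> complex_vector.span {x i | i. i < r \<and> d i = k}"

lemma layer_subset: "layer k \<subseteq> \<Gamma> k"
  using x_\<Gamma> by (intro complex_vector.span_minimal subspace_\<Gamma>) auto

lemma shifted_add: "shifted \<chi> (y + z) = shifted \<chi> y + shifted \<chi> z"
  by (simp add: shifted_def uea_incl_add \<chi>_add scaleC_add_left)

lemma shifted_scale: "shifted \<chi> (c *\<^sub>C z) = c *\<^sub>C shifted \<chi> z"
  by (simp add: shifted_def uea_incl_scale \<chi>_scale complex_vector.scale_right_diff_distrib
      scaleC_scaleC)

lemma shifted_zero: "shifted \<chi> 0 = 0"
  using shifted_add[of 0 0] by simp

lemma shifted_span_induct:
  assumes z: "z \<in> complex_vector.span S"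
    and zero: "P 0" and add: "\<And>p q. P p \<Longrightarrow> P q \<Longrightarrow> P (p + q)"
    and scale: "\<And>c p. P p \<Longrightarrow> P (c *\<^sub>C p)"
    and gen: "\<And>y. y \<in> S \<Longrightarrow> P (shifted \<chi> y * p)"
  shows "P (shifted \<chi> z * p)"
  using z
proof (induction rule: complex_vector.span_induct_alt)
  case base
  then show ?case by (simp add: shifted_zero zero)
next
  case (step c y z)
  then show ?case
    by (simp add: shifted_add shifted_scale distrib_right uea_scale_mult_left add scale gen)
qed

text \<open>The Kazhdan degree of the monomial with index list \<open>c\<close>: an element of
  \<open>\<Gamma> j\<close> has degree 2 - j, and \<open>u i\<close> lies in
  \<open>\<Gamma> (2 - d i)\<close>.\<close>

definition weight :: "nat list \<Rightarrow> int" where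
  "weight c = (\<Sum>i\<leftarrow>c. d i)"

definition lower :: "nat list \<Rightarrow> 'g uea \<Rightarrow> 'g uea" where
  "lower a p = fold (\<lambda>i p. shifted \<chi> (x i) * p) a p"

text \<open>Here the head of the list is the outermost factor, whereas \<open>lower\<close> applies
  its head first. Thus in \<open>lower a (raise c v)\<close> the two heads meet, and both lists can
  be consumed from the front.\<close>

definition raise :: "nat list \<Rightarrow> 'g uea \<Rightarrow> 'g uea" where
  "raise c v = foldr (\<lambda>j p. uea_incl (u j) * p) c v"

lemma weight_simps [simp]: "weight [] = 0" "weight (i # c) = d i + weight c"
  "weight (a @ c) = weight a + weight c"
  by (simp_all add: weight_def)

lemma lower_simps [simp]: "lower [] p = p" "lower (i # a) p = lower a (shifted \<chi> (x i) * p)"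
  "lower (a @ b) p = lower b (lower a p)"
  by (simp_all add: lower_def)

lemma raise_simps [simp]: "raise [] p = p" "raise (i # a) p = uea_incl (u i) * raise a p"
  by (simp_all add: raise_def)

lemma lower_linear: "\<exists>A. \<forall>p. lower a p = A * p"
proof (induction a)
  case Nil
  show ?case by (rule exI[of _ 1]) simp
next
  case (Cons i a)
  then obtain A where "\<forall>p. lower a p = A * p" by blast
  then show ?case by (intro exI[of _ "A * shifted \<chi> (x i)"]) (simp add: mult.assoc)
qed

lemma lower_add: "lower a (p + q) = lower a p + lower a q"
  and lower_diff: "lower a (p - q) = lower a p - lower a q"
  and lower_scale: "lower a (c *\<^sub>C p) = c *\<^sub>C lower a p"
  and lower_zero: "lower a 0 = 0"
  and lower_sum: "lower a (\<Sum>s\<in>S. g s) = (\<Sum>s\<in>S. lower a (g s))"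
  using lower_linear[of a]
  by (auto simp: distrib_left right_diff_distrib uea_scale_mult_right sum_distrib_left)

lemma raise_eq_mult: "raise c v = raise c 1 * v"
  by (induction c) (simp_all add: mult.assoc)

lemma raise_add: "raise c (p + q) = raise c p + raise c q"
  and raise_diff: "raise c (p - q) = raise c p - raise c q"
  and raise_zero: "raise c 0 = 0"
  and raise_mult: "raise c (p * q) = raise c p * q"
  using raise_eq_mult[of c]
  by (metis distrib_left, metis right_diff_distrib, metis mult_zero_right, metis mult.assoc)

definition monomials :: "nat list set" where
  "monomials = {a. sorted a \<and> set a \<subseteq> {..<r}}"

text \<open>The order in which \<open>lower a \<circ> raise c\<close> is triangular on Whittaker vectors.  Within one weight the
  lexicographic order has to be reversed.\<close>

definition precedes :: "nat list \<Rightarrow> nat list \<Rightarrow> bool" where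
  "precedes c a \<longleftrightarrow> weight c < weight a \<or> weight c = weight a \<and> (a, c) \<in> lexord {(i, j). i < j}"

text \<open>Every monomial has finitely many predecessors, so the order embeds into the natural
  numbers. This makes a maximal term, and induction from the leading term downwards,
  available.\<close>

definition rank :: "nat list \<Rightarrow> nat" where
  "rank a = card {b \<in> monomials. precedes b a}"

lemma length_le_weight: "set c \<subseteq> {..<r} \<Longrightarrow> int (length c) \<le> weight c"
  using d_pos by (induction c) fastforce+

text \<open>Each index contributes at least 1 to the weight, so a bound on the weight bounds the
  length.\<close>

lemma finite_monomials: "finite {b \<in> monomials. weight b \<le> n}"
proof (rule finite_subset)
  show "{b \<in> monomials. weight b \<le> n} \<subseteq> {b. set b \<subseteq> {..<r} \<and> length b \<le> nat n}"
    using length_le_weight by (fastforce simp: monomials_def)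
qed (intro finite_lists_length_le finite_lessThan)

lemma precedes_weight: "precedes c a \<Longrightarrow> weight c \<le> weight a"
  by (auto simp: precedes_def)

lemma precedes_irrefl: "\<not> precedes a a"
  by (auto simp: precedes_def lexord_irreflexive)

lemma precedes_trans: "precedes a b \<Longrightarrow> precedes b c \<Longrightarrow> precedes a c"
  unfolding precedes_def by (auto intro: lexord_trans simp: trans_def)

lemma precedes_linear: "precedes a b \<or> a = b \<or> precedes b a"
proof -
  have "(a, b) \<in> lexord {(i, j). i < j} \<or> a = b \<or> (b, a) \<in> lexord {(i, j). i < j}"
    by (rule lexord_linear) auto
  then show ?thesis by (auto simp: precedes_def)
qed

lemma finite_precedes: "finite {b \<in> monomials. precedes b a}"
  by (rule finite_subset[OF _ finite_monomials[of "weight a"]]) (auto dest: precedes_weight)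

lemma rank_less: "a \<in> monomials \<Longrightarrow> precedes a b \<Longrightarrow> rank a < rank b"
  unfolding rank_def using precedes_irrefl precedes_trans
  by (intro psubset_card_mono finite_precedes) blast

lemma precedes_if_rank_less: "b \<in> monomials \<Longrightarrow> rank a < rank b \<Longrightarrow> precedes a b"
  using precedes_linear[of a b] rank_less[of b a] by auto

lemma rank_inj: "a \<in> monomials \<Longrightarrow> b \<in> monomials \<Longrightarrow> rank a = rank b \<Longrightarrow> a = b"
  using precedes_linear[of a b] rank_less[of b a] rank_less[of a b] by auto

text \<open>Monomials of weight at most n form an initial segment, so their number bounds their
  ranks. This turns a bound from the filtration into a bound on ranks.\<close>

lemma weight_gt_if_rank_gt: "card {b \<in> monomials. weight b \<le> n} < rank a \<Longrightarrow> n < weight a"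
proof (rule ccontr)
  assume "card {b \<in> monomials. weight b \<le> n} < rank a" "\<not> n < weight a"
  moreover have "rank a \<le> card {b \<in> monomials. weight b \<le> weight a}"
    unfolding rank_def by (intro card_mono finite_monomials) (auto dest: precedes_weight)
  moreover have "card {b \<in> monomials. weight b \<le> weight a} \<le> card {b \<in> monomials. weight b \<le> n}"
    using \<open>\<not> n < weight a\<close> by (intro card_mono finite_monomials) auto
  ultimately show False by simp
qed

lemma Nil_monomials: "[] \<in> monomials"
  by (simp add: monomials_def)

end

section \<open>Whittaker vectors and the Kazhdan filtration modulo a left ideal\<close>

locale whittaker_ideal = dual_bases +
  fixes I :: "'a uea set"
  assumes I_zero: "0 \<in> I"
    and I_add: "p \<in> I \<Longrightarrow> q \<in> I \<Longrightarrow> p + q \<in> I"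
    and I_mult: "p \<in> I \<Longrightarrow> R * p \<in> I"
begin

lemma I_scale: "p \<in> I \<Longrightarrow> c *\<^sub>C p \<in> I"
  by (subst uea_scaleC_eq_mult) (rule I_mult)

lemma I_diff: "p \<in> I \<Longrightarrow> q \<in> I \<Longrightarrow> p - q \<in> I"
  using I_add[of p "(-1) * q"] I_mult[of q "-1"] by simp

lemma I_sum: "(\<And>s. s \<in> S \<Longrightarrow> g s \<in> I) \<Longrightarrow> (\<Sum>s\<in>S. g s) \<in> I"
  by (induction S rule: infinite_finite_induct) (auto intro: I_zero I_add)

lemma lower_I: "p \<in> I \<Longrightarrow> lower a p \<in> I"
  using lower_linear[of a] I_mult by auto

lemma raise_I: "p \<in> I \<Longrightarrow> raise a p \<in> I"
  by (subst raise_eq_mult) (rule I_mult)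

text \<open>The full preimage of the Whittaker vectors of U/I, hence containing \<open>I\<close>. As
  \<open>I\<close> is an arbitrary left ideal, the same \<chi> and \<open>x\<close> can be used
  modulo two different ideals.\<close>

definition whittaker :: "'a uea set" where
  "whittaker = {p. \<forall>i<r. shifted \<chi> (x i) * p \<in> I}"

text \<open>The Kazhdan filtration of the submodule generated by \<open>v\<close>, elements of \<open>\<Gamma> j\<close> having
  degree \<open>2 - j\<close>.  Since only generators of positive degree are admitted, it vanishes modulo
  \<open>I\<close> in negative degrees.\<close>

inductive fil :: "'a uea \<Rightarrow> int \<Rightarrow> 'a uea \<Rightarrow> bool" for v where
  fil_I: "p \<in> I \<Longrightarrow> fil v n p"
| fil_base: "0 \<le> n \<Longrightarrow> fil v n (c *\<^sub>C v)"
| fil_add: "fil v n p \<Longrightarrow> fil v n q \<Longrightarrow> fil v n (p + q)"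
| fil_step: "y \<in> \<Gamma> j \<Longrightarrow> j \<le> 1 \<Longrightarrow> fil v (n + j - 2) p \<Longrightarrow> fil v n (uea_incl y * p)"

lemma fil_mono: "fil v n p \<Longrightarrow> n \<le> k \<Longrightarrow> fil v k p"
proof (induction arbitrary: k rule: fil.induct)
  case (fil_step y j n p)
  show ?case
    by (rule fil.fil_step[OF fil_step.hyps(1,2) fil_step.IH]) (use fil_step.prems in simp)
qed (auto intro: fil.intros)

lemma fil_neg: "fil v n p \<Longrightarrow> n < 0 \<Longrightarrow> p \<in> I"
  by (induction rule: fil.induct) (auto intro: I_add I_mult)

lemma fil_scale: "fil v n p \<Longrightarrow> fil v n (c *\<^sub>C p)"
proof (induction rule: fil.induct)
  case (fil_step y j n p)
  then show ?case
    using fil.fil_step[OF fil_step.hyps(1,2), of v n "c *\<^sub>C p"] by (simp add: uea_scale_mult_right)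
qed (auto intro: fil.intros I_scale simp: scaleC_scaleC scaleC_add_right)

lemma fil_zero: "fil v n 0"
  by (intro fil_I I_zero)

text \<open>Moving \<open>z\<close> past a generator \<open>y\<close> of \<open>\<Gamma> j\<close>
  leaves a bracket in \<open>\<Gamma> (k + j)\<close>. If k + j is at most 1, it is an admissible
  generator of the right degree. Otherwise it lies in a layer: its shifted form is handled by
  induction, which is why \<open>z\<close> and \<open>k\<close> are generalized, and its scalar can
  be nonzero only for k + j = 2, where the degree is exactly n - k.\<close>

lemma fil_shifted_layer:
  assumes v: "v \<in> whittaker"
  shows "fil v n p \<Longrightarrow> z \<in> layer k \<Longrightarrow> fil v (n - k) (shifted \<chi> z * p)"
proof (induction arbitrary: z k rule: fil.induct)
  case (fil_I p n)
  then show ?case by (auto intro: fil.fil_I I_mult)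
next
  case (fil_base n c)
  have "shifted \<chi> z * v \<in> I"
    using fil_base.prems
    by (rule shifted_span_induct) (use v in \<open>auto simp: whittaker_def intro: I_zero I_add I_scale\<close>)
  then show ?case
    by (auto intro!: fil.fil_I I_scale simp: uea_scale_mult_right)
next
  case (fil_add n p q)
  then show ?case by (auto intro: fil.fil_add simp: distrib_left)
next
  case (fil_step y j n p)
  define w where "w = bracket z y"
  have w: "w \<in> \<Gamma> (k + j)"
    unfolding w_def using fil_step layer_subset by (intro bracket_\<Gamma>) auto
  have "fil v (n + j - 2 - k) (shifted \<chi> z * p)"
    by (rule fil_step.IH) fact
  then have 1: "fil v (n - k) (uea_incl y * (shifted \<chi> z * p))"
    by (intro fil.fil_step[OF fil_step.hyps(1,2)]) (simp add: algebra_simps)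
  have 2: "fil v (n - k) (uea_incl w * p)"
  proof (cases "k + j \<le> 1")
    case True
    then show ?thesis
      by (rule fil.fil_step[OF w]) (use fil_step.hyps(3) in \<open>simp add: algebra_simps\<close>)
  next
    case False
    then have "w \<in> layer (k + j)" using w \<Gamma>_span_x[of "k + j"] by auto
    then have "fil v (n + j - 2 - (k + j)) (shifted \<chi> w * p)" by (rule fil_step.IH)
    then have "fil v (n - k) (shifted \<chi> w * p)" by (rule fil_mono) simp
    moreover have "fil v (n - k) (\<chi> w *\<^sub>C p)"
    proof (cases "k + j = 2")
      case True
      then have "n - k = n + j - 2" by simp
      then show ?thesis using fil_step.hyps(3) by (simp only: fil_scale)
    next
      case False
      then show ?thesis using w \<chi>_\<Gamma> by (simp add: fil_zero)
    qed
    ultimately show ?thesis by (subst uea_incl_eq_shifted[of _ _ \<chi>]) (rule fil.fil_add)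
  qed
  show ?case
    unfolding shifted_commute_incl using 1 2 by (auto intro: fil.fil_add simp: w_def)
qed

lemma x_layer: "i < r \<Longrightarrow> x i \<in> layer (d i)"
  by (rule complex_vector.span_base) auto

lemma fil_lower:
  "v \<in> whittaker \<Longrightarrow> set a \<subseteq> {..<r} \<Longrightarrow> fil v n p \<Longrightarrow> fil v (n - weight a) (lower a p)"
proof (induction a arbitrary: n p)
  case (Cons i a)
  from Cons.prems have "fil v (n - d i - weight a) (lower a (shifted \<chi> (x i) * p))"
    by (intro Cons.IH fil_shifted_layer x_layer) auto
  then show ?case by (simp add: algebra_simps)
qed simp

lemma fil_raise_step: "i < r \<Longrightarrow> fil v n p \<Longrightarrow> fil v (n + d i) (uea_incl (u i) * p)"
  using d_pos[of i] by (intro fil_step[OF u_\<Gamma>]) auto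

lemma fil_raise: "set c \<subseteq> {..<r} \<Longrightarrow> fil v (weight c) (raise c v)"
proof (induction c)
  case Nil
  show ?case using fil_base[of 0 v 1] by (simp add: scaleC_one)
next
  case (Cons i c)
  then show ?case using fil_raise_step[of i v "weight c" "raise c v"] by (simp add: add.commute)
qed

section \<open>Triangularity of lowering against raising\<close>

lemma lower_raise_weight:
  assumes "v \<in> whittaker" "set a \<subseteq> {..<r}" "set c \<subseteq> {..<r}" "weight c < weight a"
  shows "lower a (raise c v) \<in> I"
  using fil_neg[OF fil_lower[OF assms(1,2) fil_raise[OF assms(3)]]] assms(4) by simp

lemma lower_neg:
  assumes "v \<in> whittaker" "set a \<subseteq> {..<r}" "fil v n p" "n < weight a"
  shows "lower a p \<in> I"
  using fil_neg[OF fil_lower[OF assms(1-3)]] assms(4) by simp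

text \<open>Degrees decrease along the index, so for i \<le> j the bracket has degree d i + 2 - d j
  \<ge> 2 and lies in a layer. Duality determines its scalar, and the shifted part falls strictly
  below the expected degree n + d j - d i.\<close>

lemma fil_bracket_x_u:
  assumes v: "v \<in> whittaker" and ij: "i \<le> j" "j < r" and p: "fil v n p"
  shows "fil v (n + d j - d i - 1) (uea_incl (bracket (x i) (u j)) * p - (if i = j then p else 0))"
proof -
  define w where "w = bracket (x i) (u j)"
  have "w \<in> \<Gamma> (d i + (2 - d j))"
    unfolding w_def using ij by (intro bracket_\<Gamma> x_\<Gamma> u_\<Gamma>) auto
  then have "w \<in> layer (d i + (2 - d j))"
    using \<Gamma>_span_x[of "d i + (2 - d j)"] d_antimono[OF ij] by auto
  then have "fil v (n - (d i + (2 - d j))) (shifted \<chi> w * p)"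
    by (rule fil_shifted_layer[OF v p])
  then have "fil v (n + d j - d i - 1) (shifted \<chi> w * p)"
    by (rule fil_mono) simp
  moreover have "uea_incl w * p - (if i = j then p else 0) = shifted \<chi> w * p"
    using dual[of i j] ij by (simp add: uea_incl_eq_shifted[of _ _ \<chi>] w_def scaleC_one)
  ultimately show ?thesis by (simp add: w_def)
qed

text \<open>Each \<open>u j\<close> with j > i commutes with \<open>x i\<close> up to a term one
  degree lower than expected, since the scalar of the bracket is 0. At the end \<open>x i\<close>
  reaches \<open>v\<close>, which is annihilated modulo \<open>I\<close>.\<close>

lemma lower_raise_less:
  assumes v: "v \<in> whittaker" and i: "i < r"
  shows "set c \<subseteq> {i<..<r} \<Longrightarrow> fil v (weight c - d i - 1) (shifted \<chi> (x i) * raise c v)"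
proof (induction c)
  case Nil
  then show ?case using v i by (auto intro: fil_I simp: whittaker_def)
next
  case (Cons j c)
  then have j: "i < j" "j < r" and c: "set c \<subseteq> {i<..<r}" "set c \<subseteq> {..<r}" by auto
  have "fil v (weight c - d i - 1 + d j) (uea_incl (u j) * (shifted \<chi> (x i) * raise c v))"
    using Cons.IH[OF c(1)] j by (intro fil_raise_step)
  moreover have "fil v (weight c + d j - d i - 1) (uea_incl (bracket (x i) (u j)) * raise c v)"
    using fil_bracket_x_u[OF v _ j(2) fil_raise[OF c(2)], of i] j by simp
  ultimately show ?case
    by (simp add: shifted_commute_incl algebra_simps fil_add)
qed

text \<open>Up to lower degree, the shifted \<open>x i\<close> acts as the partial derivative in
  \<open>u i\<close>; the multiplicity of \<open>i\<close> is the exponent that comes down.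
  Sortedness puts all factors \<open>u i\<close> in front.\<close>

lemma lower_raise_eq:
  assumes v: "v \<in> whittaker"
  shows "sorted (i # c) \<Longrightarrow> set (i # c) \<subseteq> {..<r} \<Longrightarrow>
    fil v (weight c - 1)
      (shifted \<chi> (x i) * raise (i # c) v - of_nat (count_list (i # c) i) *\<^sub>C raise c v)"
proof (induction c)
  case Nil
  then have i: "i < r" by simp
  have vv: "fil v 0 v" using fil_base[of 0 v 1] by (simp add: scaleC_one)
  have "fil v (-1) (uea_incl (bracket (x i) (u i)) * v - v)"
    using fil_bracket_x_u[OF v _ i vv, of i] by simp
  moreover have "fil v (-1) (uea_incl (u i) * (shifted \<chi> (x i) * v))"
    using v i by (auto intro: fil_I I_mult simp: whittaker_def)
  ultimately have "fil v (-1) (uea_incl (u i) * (shifted \<chi> (x i) * v) +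
      (uea_incl (bracket (x i) (u i)) * v - v))"
    by (intro fil_add)
  then show ?case by (simp add: shifted_commute_incl scaleC_one algebra_simps)
next
  case (Cons j c)
  then have i: "i < r" and j: "j < r" "i \<le> j" and c: "set c \<subseteq> {..<r}" by auto
  define k where "k = count_list (j # c) i"
  let ?p = "raise (j # c) v"
  have "fil v (weight (j # c) + d i - d i - 1) (uea_incl (bracket (x i) (u i)) * ?p - ?p)"
    using fil_bracket_x_u[OF v _ i fil_raise, of i "j # c"] Cons.prems(2) by simp
  then have 1: "fil v (weight (j # c) - 1) (uea_incl (bracket (x i) (u i)) * ?p - ?p)" by simp
  have 2: "fil v (weight (j # c) - 1) (uea_incl (u i) * (shifted \<chi> (x i) * ?p) - of_nat k *\<^sub>C ?p)"
  \<comment> \<open>A further copy of \<open>u i\<close> contributes by the induction hypothesis; if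
    there is none, only larger indices remain and the multiplicity \<open>k\<close> is 0.\<close>
  proof (cases "i = j")
    case True
    have "fil v (weight c - 1) (shifted \<chi> (x i) * raise (i # c) v - of_nat k *\<^sub>C raise c v)"
      using Cons True unfolding k_def by simp
    then have "fil v (weight c - 1 + d i)
        (uea_incl (u i) * (shifted \<chi> (x i) * raise (i # c) v - of_nat k *\<^sub>C raise c v))"
      by (rule fil_raise_step[OF i])
    then show ?thesis
      using True by (simp add: right_diff_distrib uea_scale_mult_right algebra_simps)
  next
    case False
    then have "set (j # c) \<subseteq> {i<..<r}" using Cons.prems j by fastforce
    then have "fil v (weight (j # c) - d i - 1) (shifted \<chi> (x i) * ?p)"
      by (rule lower_raise_less[OF v i])
    then have "fil v (weight (j # c) - d i - 1 + d i) (uea_incl (u i) * (shifted \<chi> (x i) * ?p))"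
      by (rule fil_raise_step[OF i])
    moreover have "k = 0"
      using \<open>set (j # c) \<subseteq> {i<..<r}\<close> unfolding k_def by (intro count_notin) auto
    ultimately show ?thesis by (simp add: algebra_simps)
  qed
  have "shifted \<chi> (x i) * raise (i # j # c) v - of_nat (count_list (i # j # c) i) *\<^sub>C ?p =
      (uea_incl (u i) * (shifted \<chi> (x i) * ?p) - of_nat k *\<^sub>C ?p) +
      (uea_incl (bracket (x i) (u i)) * ?p - ?p)"
    by (simp add: shifted_commute_incl k_def scaleC_add_left scaleC_one)
  then show ?case using fil_add[OF 2 1] by simp
qed

text \<open>Equal heads cancel by differentiation and leave the tails in the same order. At the
  first difference i < j the index \<open>i\<close> does not occur in \<open>c\<close>, so the
  degree drops by an extra unit; as the weights are equal, the final degree is negative.\<close>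

lemma lower_raise_lexord:
  assumes v: "v \<in> whittaker"
  shows "sorted a \<Longrightarrow> sorted c \<Longrightarrow> set a \<subseteq> {..<r} \<Longrightarrow> set c \<subseteq> {..<r} \<Longrightarrow> weight a = weight c \<Longrightarrow>
    (a, c) \<in> lexord {(i, j). i < j} \<Longrightarrow> lower a (raise c v) \<in> I"
proof (induction a arbitrary: c)
  case Nil
  then show ?case using length_le_weight[of c] by auto
next
  case (Cons i a)
  then obtain j c' where c: "c = j # c'" by (cases c) auto
  have i: "i < r" and a: "set a \<subseteq> {..<r}" using Cons.prems by auto
  show ?case
  proof (cases "i = j")
    case True
    let ?q = "of_nat (count_list (i # c') i) *\<^sub>C raise c' v"
    have "fil v (weight c' - 1) (shifted \<chi> (x i) * raise c v - ?q)"
      using lower_raise_eq[OF v, of i c'] Cons.prems True c by simp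
    then have "lower a (shifted \<chi> (x i) * raise c v - ?q) \<in> I"
      by (rule lower_neg[OF v a]) (use Cons.prems True c in simp)
    moreover have "lower a ?q \<in> I"
      unfolding lower_scale using Cons.prems True c by (intro I_scale Cons.IH) auto
    ultimately show ?thesis
      using I_add by (fastforce simp: lower_diff)
  next
    case False
    then have "i < j" using Cons.prems c by auto
    then have "set c \<subseteq> {i<..<r}" using Cons.prems c by fastforce
    then have "fil v (weight c - d i - 1) (shifted \<chi> (x i) * raise c v)"
      by (rule lower_raise_less[OF v i])
    then show ?thesis
      using lower_neg[OF v a] Cons.prems by simp
  qed
qed

text \<open>The diagonal entry is the iterated derivative of a monomial by itself: a product of
  positive multiplicities, hence nonzero over the complex numbers.\<close>

lemma lower_raise_self:
  assumes v: "v \<in> whittaker"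
  shows "sorted a \<Longrightarrow> set a \<subseteq> {..<r} \<Longrightarrow> \<exists>k. k \<noteq> 0 \<and> lower a (raise a v) - k *\<^sub>C v \<in> I"
proof (induction a)
  case Nil
  show ?case by (rule exI[of _ 1]) (simp add: scaleC_one I_zero)
next
  case (Cons i a)
  then obtain k where k: "k \<noteq> 0" "lower a (raise a v) - k *\<^sub>C v \<in> I" by auto
  let ?n = "of_nat (count_list (i # a) i) :: complex"
  have "lower a (shifted \<chi> (x i) * raise (i # a) v - ?n *\<^sub>C raise a v) \<in> I"
    using lower_raise_eq[OF v Cons.prems] Cons.prems by (intro lower_neg[OF v]) auto
  then have "lower (i # a) (raise (i # a) v) - ?n *\<^sub>C lower a (raise a v) \<in> I"
    by (simp add: lower_diff lower_scale)
  moreover have "?n *\<^sub>C (lower a (raise a v) - k *\<^sub>C v) \<in> I"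
    using k by (intro I_scale)
  ultimately have "(lower (i # a) (raise (i # a) v) - ?n *\<^sub>C lower a (raise a v)) +
      ?n *\<^sub>C (lower a (raise a v) - k *\<^sub>C v) \<in> I"
    by (rule I_add)
  then have "lower (i # a) (raise (i # a) v) - (?n * k) *\<^sub>C v \<in> I"
    by (simp add: complex_vector.scale_right_diff_distrib scaleC_scaleC)
  moreover have "?n * k \<noteq> 0" using k by (simp del: of_nat_Suc)
  ultimately show ?case by blast
qed

lemma lower_raise_precedes:
  assumes "v \<in> whittaker" "a \<in> monomials" "c \<in> monomials" "precedes c a"
  shows "lower a (raise c v) \<in> I"
  using assms lower_raise_weight[of v a c] lower_raise_lexord[of v a c]
  by (auto simp: precedes_def monomials_def)

section \<open>Independence of the monomials over Whittaker vectors\<close>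

lemma whittaker_zero: "0 \<in> whittaker"
  and whittaker_add: "p \<in> whittaker \<Longrightarrow> q \<in> whittaker \<Longrightarrow> p + q \<in> whittaker"
  and whittaker_diff: "p \<in> whittaker \<Longrightarrow> q \<in> whittaker \<Longrightarrow> p - q \<in> whittaker"
  and whittaker_scale: "p \<in> whittaker \<Longrightarrow> c *\<^sub>C p \<in> whittaker"
  by (auto simp: whittaker_def I_zero distrib_left right_diff_distrib uea_scale_mult_right
      intro: I_add I_diff I_scale)

text \<open>Among the monomials with coefficient outside \<open>I\<close>, take the one of largest
  rank. Lowering by it sends all other terms into \<open>I\<close> and returns a nonzero multiple of
  its own coefficient.\<close>

lemma raise_sum_unique:
  assumes S: "finite S" "S \<subseteq> monomials" and w: "\<And>c. c \<in> S \<Longrightarrow> w c \<in> whittaker"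
    and sum: "(\<Sum>c\<in>S. raise c (w c)) \<in> I" and c: "c \<in> S"
  shows "w c \<in> I"
proof (rule ccontr)
  assume "w c \<notin> I"
  define T where "T = {c \<in> S. w c \<notin> I}"
  have T: "finite T" "T \<noteq> {}" using S c \<open>w c \<notin> I\<close> by (auto simp: T_def)
  then have "Max (rank ` T) \<in> rank ` T" by (intro Max_in) auto
  then obtain a where a: "a \<in> T" "rank a = Max (rank ` T)" by auto
  then have a': "a \<in> S" "a \<in> monomials" "w a \<in> whittaker" "w a \<notin> I"
    using S w by (auto simp: T_def)
  have "lower a (raise b (w b)) \<in> I" if b: "b \<in> S - {a}" for b
  proof (cases "b \<in> T")
    case True
    then have "rank b < rank a"
      using Max_ge[OF finite_imageI[OF T(1)] imageI[OF True], of rank] rank_inj[of b a] a a' b S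
      by (auto simp: le_less)
    then show ?thesis
      using a' b S w by (intro lower_raise_precedes precedes_if_rank_less) auto
  next
    case False
    then show ?thesis using b by (intro lower_I raise_I) (auto simp: T_def)
  qed
  then have "(\<Sum>b\<in>S - {a}. lower a (raise b (w b))) \<in> I" by (rule I_sum)
  moreover have "(\<Sum>b\<in>S. lower a (raise b (w b))) \<in> I"
    using lower_I[OF sum, of a] by (simp add: lower_sum)
  ultimately have "lower a (raise a (w a)) \<in> I"
    using I_diff sum.remove[OF S(1) a'(1), of "\<lambda>b. lower a (raise b (w b))"]
    by (metis add_diff_cancel_right')
  moreover obtain k where "k \<noteq> 0" "lower a (raise a (w a)) - k *\<^sub>C w a \<in> I"
    using lower_raise_self[OF a'(3)] a'(2) by (auto simp: monomials_def)
  ultimately have "k *\<^sub>C w a \<in> I" using I_diff by fastforce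
  then have "inverse k *\<^sub>C (k *\<^sub>C w a) \<in> I" by (rule I_scale)
  then show False using \<open>k \<noteq> 0\<close> a'(4) by (simp add: scaleC_scaleC scaleC_one)
qed

text \<open>The coefficient function is total and vanishes outside \<open>S\<close>, so two
  expansions can be added over the union of their supports.\<close>

definition expansions :: "'a uea set \<Rightarrow> 'a uea set" where
  "expansions W = {p. \<exists>S w. finite S \<and> S \<subseteq> monomials \<and> range w \<subseteq> W \<and> (\<forall>c. c \<notin> S \<longrightarrow> w c = 0) \<and>
     p - (\<Sum>c\<in>S. raise c (w c)) \<in> I}"

lemma expansions_I: "0 \<in> W \<Longrightarrow> p \<in> I \<Longrightarrow> p \<in> expansions W"
  unfolding expansions_def by (intro CollectI exI[of _ "{}"] exI[of _ "\<lambda>_. 0"]) auto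

lemma expansions_raise:
  assumes "c \<in> monomials" "w \<in> W" "0 \<in> W"
  shows "raise c w \<in> expansions W"
  unfolding expansions_def using assms
  by (intro CollectI exI[of _ "{c}"] exI[of _ "\<lambda>b. if b = c then w else 0"]) (auto simp: I_zero)

lemma expansions_add:
  assumes W: "\<And>v w. v \<in> W \<Longrightarrow> w \<in> W \<Longrightarrow> v + w \<in> W"
    and p: "p \<in> expansions W" and q: "q \<in> expansions W"
  shows "p + q \<in> expansions W"
proof -
  obtain S v where S: "finite S" "S \<subseteq> monomials" "range v \<subseteq> W" "\<forall>c. c \<notin> S \<longrightarrow> v c = 0"
      "p - (\<Sum>c\<in>S. raise c (v c)) \<in> I"
    using p unfolding expansions_def by blast
  obtain T w where T: "finite T" "T \<subseteq> monomials" "range w \<subseteq> W" "\<forall>c. c \<notin> T \<longrightarrow> w c = 0"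
      "q - (\<Sum>c\<in>T. raise c (w c)) \<in> I"
    using q unfolding expansions_def by blast
  have "(\<Sum>c\<in>S. raise c (v c)) = (\<Sum>c\<in>S \<union> T. raise c (v c))"
    "(\<Sum>c\<in>T. raise c (w c)) = (\<Sum>c\<in>S \<union> T. raise c (w c))"
    using S T by (intro sum.mono_neutral_left; auto simp: raise_zero)+
  then have "p + q - (\<Sum>c\<in>S \<union> T. raise c (v c + w c)) =
      (p - (\<Sum>c\<in>S. raise c (v c))) + (q - (\<Sum>c\<in>T. raise c (w c)))"
    by (simp add: raise_add sum.distrib)
  also have "\<dots> \<in> I" using S T by (intro I_add)
  finally have "p + q - (\<Sum>c\<in>S \<union> T. raise c (v c + w c)) \<in> I" .
  moreover have "range (\<lambda>c. v c + w c) \<subseteq> W"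
    using S(3) T(3) by (intro image_subsetI W) auto
  ultimately show ?thesis
    unfolding expansions_def using S(1,2,4) T(1,2,4)
    by (intro CollectI exI[of _ "S \<union> T"] exI[of _ "\<lambda>c. v c + w c"]) simp
qed

lemma expansions_induct [consumes 1, case_names ideal raise add]:
  assumes "p \<in> expansions W"
    and "\<And>i. i \<in> I \<Longrightarrow> P i" and "\<And>c w. c \<in> monomials \<Longrightarrow> w \<in> W \<Longrightarrow> P (raise c w)"
    and add: "\<And>p q. P p \<Longrightarrow> P q \<Longrightarrow> P (p + q)"
  shows "P p"
proof -
  obtain S w where S: "finite S" "S \<subseteq> monomials" "range w \<subseteq> W" "p - (\<Sum>c\<in>S. raise c (w c)) \<in> I"
    using assms(1) unfolding expansions_def by blast
  have "P (\<Sum>c\<in>S. raise c (w c))"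
    using S(1,2)
  proof (induction S rule: finite_induct)
    case empty
    then show ?case using assms(2)[OF I_zero] by simp
  next
    case (insert c S)
    then show ?case using S(3) assms(3) by (auto intro!: add)
  qed
  then show ?thesis
    using add[OF assms(2)[OF S(4)], of "\<Sum>c\<in>S. raise c (w c)"] by simp
qed

text \<open>A Whittaker vector is its own expansion, with the empty monomial only. Subtract this
  from the given expansion and apply independence; the empty list is adjoined to \<open>S\<close>
  because it may be missing there.\<close>

lemma expansion_constant_term:
  assumes p: "p \<in> whittaker" and S: "finite S" "S \<subseteq> monomials"
    and w: "range w \<subseteq> whittaker" and w0: "\<forall>c. c \<notin> S \<longrightarrow> w c = 0"
    and sum: "p - (\<Sum>c\<in>S. raise c (w c)) \<in> I"
  shows "p - w [] \<in> I"
proof -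
  define v where "v c = (if c = [] then p else 0) - w c" for c
  have "(\<Sum>c\<in>S. raise c (w c)) = (\<Sum>c\<in>insert [] S. raise c (w c))"
    using S w0 by (intro sum.mono_neutral_left) (auto simp: raise_zero)
  moreover have "(\<Sum>c\<in>insert [] S. raise c (if c = [] then p else 0)) =
      (\<Sum>c\<in>insert [] S. if c = [] then p else 0)"
    by (rule sum.cong) (auto simp: raise_zero)
  ultimately have "(\<Sum>c\<in>insert [] S. raise c (v c)) = p - (\<Sum>c\<in>S. raise c (w c))"
    using S by (simp add: v_def raise_diff sum_subtractf)
  moreover have "v c \<in> whittaker" for c
    unfolding v_def using p w whittaker_zero by (intro whittaker_diff) auto
  ultimately have "v [] \<in> I"
    using S Nil_monomials sum by (intro raise_sum_unique[of "insert [] S" v]) auto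
  then show ?thesis by (simp add: v_def)
qed

section \<open>Straightening of products and the spanning property\<close>

lemma lower_layer:
  assumes "z \<in> layer k" and "\<And>l. l < r \<Longrightarrow> d l = k \<Longrightarrow> lower (l # b) p \<in> I"
  shows "lower b (shifted \<chi> z * p) \<in> I"
  using assms(1)
  by (rule shifted_span_induct)
    (use assms(2) in \<open>auto simp: lower_zero lower_add lower_scale I_zero I_add I_scale\<close>)

text \<open>\<chi> vanishes on the bracket of two \<open>x\<close>, so exchanging neighbours costs
  exactly a shifted bracket. That bracket has degree at least 2 and is a combination of single
  \<open>x l\<close>, giving shorter lists of the same weight.\<close>

lemma lower_swap:
  assumes ij: "i < r" "j < r" and "\<And>l. l < r \<Longrightarrow> d l = d i + d j \<Longrightarrow> lower (a @ l # b) p \<in> I"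
    and I: "lower (a @ i # j # b) p \<in> I"
  shows "lower (a @ j # i # b) p \<in> I"
proof -
  let ?z = "bracket (x i) (x j)" and ?q = "lower a p"
  have "?z \<in> layer (d i + d j)"
    using \<Gamma>_span_x[of "d i + d j"] bracket_\<Gamma>[OF x_\<Gamma>[OF ij(1)] x_\<Gamma>[OF ij(2)]]
      d_pos[OF ij(1)] d_pos[OF ij(2)] by auto
  then have 1: "lower b (shifted \<chi> ?z * ?q) \<in> I"
    by (rule lower_layer) (use assms(3) in simp)
  have "shifted \<chi> (x i) * (shifted \<chi> (x j) * ?q) =
      shifted \<chi> (x j) * (shifted \<chi> (x i) * ?q) + shifted \<chi> ?z * ?q"
    using \<chi>_bracket_x[OF ij]
    by (simp add: shifted_def uea_incl_bracket algebra_simps uea_scale_mult_left uea_scale_mult_right)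
  then show ?thesis
    using 1 I by (simp add: lower_add I_add)
qed

end

lemma insort_swap_induct:
  assumes swap: "\<And>a b i j. P (a @ i # j # b) \<Longrightarrow> P (a @ j # i # b)"
    and P: "P (a @ insort i b)"
  shows "P (a @ i # b)"
  using P
proof (induction b arbitrary: a)
  case (Cons j b)
  show ?case
  proof (cases "i \<le> j")
    case False
    then have "P ((a @ [j]) @ i # b)" using Cons.prems False by (intro Cons.IH) simp
    then show ?thesis using swap[of a j i b] by simp
  qed (use Cons.prems in simp)
qed simp

text \<open>Insertion sort consists of adjacent exchanges; undoing them carries the property from
  the sorted list back to the given one.\<close>

lemma sort_swap_induct:
  assumes swap: "\<And>a b i j. P (a @ i # j # b) \<Longrightarrow> P (a @ j # i # b)"
    and P: "P (a @ sort b)"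
  shows "P (a @ b)"
  using P
proof (induction b arbitrary: a)
  case (Cons i b)
  have "P (a @ insort i (sort b))"
    using Cons.prems by simp
  then have "P (a @ i # sort b)"
    by (rule insort_swap_induct[of P, rotated]) (rule swap)
  then have "P ((a @ [i]) @ b)" by (intro Cons.IH) simp
  then show ?case by simp
qed simp

context whittaker_ideal
begin

text \<open>Sort \<open>a\<close> by adjacent exchanges. Each error term is shorter and has the same
  weight, so it is covered by the induction on length; the predicate \<open>P\<close> records weight
  and length for this purpose.\<close>

lemma lower_straighten:
  assumes sorted: "\<And>b. b \<in> monomials \<Longrightarrow> weight b = n \<Longrightarrow> lower b p \<in> I"
  shows "set a \<subseteq> {..<r} \<Longrightarrow> weight a = n \<Longrightarrow> lower a p \<in> I"
proof (induction "length a" arbitrary: a rule: less_induct)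
  case less
  define P where "P b \<longleftrightarrow>
    set b \<subseteq> {..<r} \<and> weight b = n \<and> length b = length a \<and> lower b p \<in> I" for b
  have "mset (sort a) = mset a" by simp
  then have "weight (sort a) = n"
    using less.prems unfolding weight_def by (metis mset_map sum_mset_sum_list)
  then have "P ([] @ sort a)"
    using less.prems sorted[of "sort a"] by (simp add: P_def monomials_def)
  then have "P ([] @ a)"
  proof (rule sort_swap_induct[rotated])
    fix b c i j
    assume P: "P (b @ i # j # c)"
    then have "i < r" "j < r" by (auto simp: P_def)
    then have "lower (b @ j # i # c) p \<in> I"
    proof (rule lower_swap)
      fix l assume "l < r" "d l = d i + d j"
      with P show "lower (b @ l # c) p \<in> I" by (intro less.hyps) (auto simp: P_def)
    qed (use P in \<open>simp add: P_def\<close>)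
    then show "P (b @ j # i # c)" using P by (auto simp: P_def)
  qed
  then show ?case by (simp add: P_def)
qed

text \<open>Elimination of leading terms: lowering by the monomial of rank N extracts its
  coefficient up to a scalar, and subtracting the corresponding term decreases the bound on the
  rank.\<close>

lemma mem_expansions_if_rank_bound:
  "(\<And>a. a \<in> monomials \<Longrightarrow> N \<le> rank a \<Longrightarrow> lower a p \<in> I) \<Longrightarrow> p \<in> expansions whittaker"
proof (induction N arbitrary: p)
  case 0
  from 0[OF Nil_monomials] have "p \<in> I" by simp
  then show ?case by (intro expansions_I whittaker_zero)
next
  case (Suc N)
  show ?case
  proof (cases "\<exists>a\<in>monomials. rank a = N")
    case False
    then show ?thesis using Suc by (metis le_antisym not_less_eq_eq)
  next
    case True
    then obtain a where a: "a \<in> monomials" "rank a = N" by blast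
    have killed: "lower b p \<in> I" if "b \<in> monomials" "precedes a b" for b
      using Suc.prems[OF that(1)] rank_less[OF a(1) that(2)] a(2) by simp
    define y where "y = lower a p"
    have y: "y \<in> whittaker"
      unfolding whittaker_def
    proof (intro CollectI allI impI)
      fix i assume i: "i < r"
      \<comment> \<open>Appending \<open>i\<close> strictly increases the weight. After
        straightening, only ordered monomials that come after \<open>a\<close> occur, and these
        already send \<open>p\<close> into \<open>I\<close>.\<close>
      have "lower (a @ [i]) p \<in> I"
      proof (rule lower_straighten)
        fix b assume "b \<in> monomials" "weight b = weight (a @ [i])"
        then show "lower b p \<in> I"
          using d_pos[OF i] by (intro killed) (auto simp: precedes_def)
      qed (use a i in \<open>auto simp: monomials_def\<close>)
      then show "shifted \<chi> (x i) * y \<in> I" by (simp add: y_def)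
    qed
    obtain k where k: "k \<noteq> 0" "lower a (raise a y) - k *\<^sub>C y \<in> I"
      using lower_raise_self[OF y] a by (auto simp: monomials_def)
    \<comment> \<open>The scalar \<open>k\<close> is the diagonal entry for \<open>y\<close>;
      dividing by it makes \<open>raise a z\<close> have the same image under \<open>lower a\<close>
      as \<open>p\<close>, modulo \<open>I\<close>.\<close>
    define z where "z = inverse k *\<^sub>C y"
    have z: "z \<in> whittaker" unfolding z_def using y by (rule whittaker_scale)
    have lower_z: "lower b (raise c z) = inverse k *\<^sub>C lower b (raise c y)" for b c
      unfolding z_def raise_eq_mult[of c "inverse k *\<^sub>C y"] uea_scale_mult_right lower_scale
      by (simp flip: raise_eq_mult)
    have "p - raise a z \<in> expansions whittaker"
    proof (rule Suc.IH)
      fix b assume b: "b \<in> monomials" "N \<le> rank b"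
      show "lower b (p - raise a z) \<in> I"
      proof (cases "b = a")
        case True
        have "(- inverse k) *\<^sub>C (lower a (raise a y) - k *\<^sub>C y) \<in> I"
          using k(2) by (rule I_scale)
        moreover have "(- inverse k) *\<^sub>C (lower a (raise a y) - k *\<^sub>C y) = y - lower a (raise a z)"
          using k(1) unfolding lower_z
          by (simp add: complex_vector.scale_right_diff_distrib scaleC_scaleC scaleC_one)
        ultimately show ?thesis using True by (simp add: lower_diff y_def)
      next
        case False
        then have "rank a < rank b" using a b rank_inj by (metis le_less)
        then have "precedes a b" using b by (intro precedes_if_rank_less)
        \<comment> \<open>For later \<open>b\<close> both terms vanish modulo \<open>I\<close>: the
          first by the bound on \<open>p\<close>, the second by triangularity. So the subtraction
          creates no new leading term.\<close>
        then show ?thesis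
          unfolding lower_diff using b a z by (intro I_diff killed lower_raise_precedes)
      qed
    qed
    moreover have "raise a z \<in> expansions whittaker"
      using a z by (intro expansions_raise whittaker_zero)
    ultimately show ?thesis
      using expansions_add[OF whittaker_add, of "p - raise a z" "raise a z"] by simp
  qed
qed

lemma fil_exhausts:
  assumes 1: "1 \<in> whittaker"
  shows "\<exists>n. fil 1 n p"
proof (induction p rule: uea_induct_left)
  case (1 c)
  show ?case using fil_base[of 0 1 c] by auto
next
  case (2 p q)
  then obtain m n where "fil 1 m p" "fil 1 n q" by blast
  then have "fil 1 (max m n) (p + q)"
    by (intro fil_add) (auto elim: fil_mono)
  then show ?case by blast
next
  case (3 y p)
  then obtain n where n: "fil 1 n p" by blast
  have "y \<in> complex_vector.span (\<Union>j. \<Gamma> j)" using span_\<Gamma> by simp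
  then show ?case
  proof (induction rule: complex_vector.span_induct_alt)
    case base
    show ?case using fil_zero by (auto simp: uea_incl_zero)
  next
    case (step c z y)
    then obtain j m where z: "z \<in> \<Gamma> j" and m: "fil 1 m (uea_incl y * p)" by blast
    have "\<exists>k. fil 1 k (uea_incl z * p)"
    proof (cases "j \<le> 1")
      case True
      then show ?thesis using fil_step[OF z True, of 1 "n + 2 - j" p] n by auto
    next
      case False
      then have "fil 1 (n - j) (shifted \<chi> z * p)"
        using z \<Gamma>_span_x[of j] n assms by (intro fil_shifted_layer) auto
      then have "fil 1 n (shifted \<chi> z * p)" by (rule fil_mono) (use False in simp)
      then show ?thesis
        using n by (auto simp: uea_incl_eq_shifted[of _ _ \<chi>] intro: fil_add fil_scale)
    qed
    then obtain k where k: "fil 1 k (uea_incl z * p)" by blast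
    have "fil 1 (max m k) (c *\<^sub>C (uea_incl z * p) + uea_incl y * p)"
      using fil_mono[OF m, of "max m k"] fil_mono[OF k, of "max m k"]
      by (intro fil_add fil_scale) auto
    then show ?case by (auto simp: uea_incl_add uea_incl_scale distrib_right uea_scale_mult_left)
  qed
qed

text \<open>The spanning half of Skryabin's theorem; freeness is \<open>raise_sum_unique\<close>.\<close>

lemma mem_expansions:
  assumes "1 \<in> whittaker"
  shows "p \<in> expansions whittaker"
proof -
  obtain n where n: "fil 1 n p" using fil_exhausts[OF assms] by blast
  show ?thesis
  proof (rule mem_expansions_if_rank_bound)
    fix a assume "a \<in> monomials" "Suc (card {b \<in> monomials. weight b \<le> n}) \<le> rank a"
    then show "lower a p \<in> I"
      using n assms weight_gt_if_rank_gt[of n a]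
      by (intro lower_neg[of 1 a n]) (auto simp: monomials_def)
  qed
qed

end


section \<open>Quantum Hamiltonian reduction\<close>

lemma left_ideal_gen: 
  assumes R: "ring R" and S: "S \<subseteq> carrier R"
  shows "left_ideal (gen_left_ideal R S) R" "S \<subseteq> gen_left_ideal R S"
    "gen_left_ideal R S \<subseteq> carrier R"
proof -
  interpret ring R by fact
  have c: "left_ideal (carrier R) R"
    unfolding left_ideal_def
    by (auto intro!: additive_subgroup.intro add.subgroup_self)
  have "subgroup (\<Inter>{I. left_ideal I R \<and> S \<subseteq> I}) (add_monoid R)"
    using c S by (intro add.subgroups_Inter) (auto simp: left_ideal_def additive_subgroup_def)
  then show "left_ideal (gen_left_ideal R S) R"
    unfolding gen_left_ideal_def left_ideal_def
    by (auto intro!: additive_subgroup.intro)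
  show "S \<subseteq> gen_left_ideal R S"
    by (auto simp: gen_left_ideal_def)
  show "gen_left_ideal R S \<subseteq> carrier R"
    using c S by (auto simp: gen_left_ideal_def)
qed

lemma gen_left_ideal_minimal: "left_ideal J R \<Longrightarrow> S \<subseteq> J \<Longrightarrow> gen_left_ideal R S \<subseteq> J"
  by (auto simp: gen_left_ideal_def)

text \<open>Closure under negation comes from left multiplication by -1.\<close>

lemma (in ring) left_idealI:
  assumes "J \<subseteq> carrier R" "\<zero> \<in> J"
    and "\<And>a b. a \<in> J \<Longrightarrow> b \<in> J \<Longrightarrow> a \<oplus> b \<in> J"
    and mult: "\<And>a b. a \<in> carrier R \<Longrightarrow> b \<in> J \<Longrightarrow> a \<otimes> b \<in> J"
  shows "left_ideal J R"
proof -
  have "\<ominus> b \<in> J" if "b \<in> J" for b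
    using mult[of "\<ominus> \<one>" b] that assms(1) by (auto simp: l_minus)
  then show ?thesis
    unfolding left_ideal_def using assms
    by (auto intro!: additive_subgroup.intro add.subgroupI simp flip: a_inv_def)
qed

text \<open>The Lie structure of \<open>m\<close> enters as commutators of its image lying in the
  ideal. In this form the locale serves both the reductions of the enveloping algebra and the second
  stage, whose ring consists of cosets.\<close>

locale hamiltonian =
  fixes R :: "(complex, 'a) module" (structure)
    and \<iota> :: "'g \<Rightarrow> 'a" and m :: "'g set" and \<chi> :: "'g \<Rightarrow> complex"
  assumes complex_algebra: "complex_algebra R"
    and \<iota>_closed: "y \<in> m \<Longrightarrow> \<iota> y \<in> carrier R"
    and \<iota>_commutator: "y \<in> m \<Longrightarrow> z \<in> m \<Longrightarrow> \<iota> y \<otimes> \<iota> z \<ominus> \<iota> z \<otimes> \<iota> y \<in> shift_ideal R \<iota> m \<chi>"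
begin

sublocale ring R
  using complex_algebra by (simp add: complex_algebra_def)

sublocale scalars: module "ring_of_type_algebra :: complex ring" R
  rewrites "carrier (ring_of_type_algebra :: complex ring) = UNIV"
    and "monoid.mult (ring_of_type_algebra :: complex ring) = (*)"
    and "add (ring_of_type_algebra :: complex ring) = (+)"
    and "one (ring_of_type_algebra :: complex ring) = 1"
  using complex_algebra by (simp_all add: complex_algebra_def ring_of_type_algebra_def)

lemma smult_closed: "a \<in> carrier R \<Longrightarrow> c \<odot> a \<in> carrier R"
  using scalars.smult_closed by simp

lemma smult_mult:
  "a \<in> carrier R \<Longrightarrow> b \<in> carrier R \<Longrightarrow> (c \<odot> a) \<otimes> b = c \<odot> (a \<otimes> b)"
  "a \<in> carrier R \<Longrightarrow> b \<in> carrier R \<Longrightarrow> a \<otimes> (c \<odot> b) = c \<odot> (a \<otimes> b)"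
  using complex_algebra by (auto simp: complex_algebra_def)

abbreviation I where "I \<equiv> shift_ideal R \<iota> m \<chi>"

definition generator :: "'g \<Rightarrow> 'a" where
  "generator y = \<iota> y \<ominus> (\<chi> y \<odot> \<one>)"

lemma generator_closed: "y \<in> m \<Longrightarrow> generator y \<in> carrier R"
  by (simp add: generator_def \<iota>_closed smult_closed)

lemma I_eq: "I = gen_left_ideal R (generator ` m)"
  by (simp add: shift_ideal_def generator_def[abs_def])

lemma left_ideal_I: "left_ideal I R" and generator_I: "y \<in> m \<Longrightarrow> generator y \<in> I"
  and I_subset: "I \<subseteq> carrier R"
  unfolding I_eq using left_ideal_gen[OF ring_axioms, of "generator ` m"] generator_closed by auto

lemma I_minimal: "left_ideal J R \<Longrightarrow> (\<And>y. y \<in> m \<Longrightarrow> generator y \<in> J) \<Longrightarrow> I \<subseteq> J"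
  unfolding I_eq by (rule gen_left_ideal_minimal) auto

sublocale I: abelian_subgroup I R
  using left_ideal_I abelian_group_axioms
  by (intro abelian_subgroupI3) (auto simp: left_ideal_def)

lemma I_mult: "a \<in> carrier R \<Longrightarrow> b \<in> I \<Longrightarrow> a \<otimes> b \<in> I"
  using left_ideal_I by (simp add: left_ideal_def)

lemma I_closed: "a \<in> I \<Longrightarrow> a \<in> carrier R"
  using I_subset by auto

lemma I_smult: "a \<in> I \<Longrightarrow> c \<odot> a \<in> I"
  using I_mult[of "c \<odot> \<one>" a] I_closed[of a] by (simp add: smult_mult smult_closed)

section \<open>Representatives of the invariants\<close>

definition ad :: "'a \<Rightarrow> 'a \<Rightarrow> 'a" where
  "ad a b = a \<otimes> b \<ominus> b \<otimes> a"

text \<open>The preimage in \<open>R\<close> of the invariants of R/I. It turns out to be a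
  subalgebra in which \<open>I\<close> is a two-sided ideal, which is what makes the product on the
  reduction well defined.\<close>

definition N :: "'a set" where
  "N = {a \<in> carrier R. \<forall>y\<in>m. ad (\<iota> y) a \<in> I}"

lemma N_closed: "a \<in> N \<Longrightarrow> a \<in> carrier R"
  by (simp add: N_def)

lemma ad_add:
  "a \<in> carrier R \<Longrightarrow> b \<in> carrier R \<Longrightarrow> c \<in> carrier R \<Longrightarrow> ad a (b \<oplus> c) = ad a b \<oplus> ad a c"
  by (simp add: ad_def l_distr r_distr minus_eq minus_add a_ac)

lemma ad_mult:
  "a \<in> carrier R \<Longrightarrow> b \<in> carrier R \<Longrightarrow> c \<in> carrier R \<Longrightarrow> ad a (b \<otimes> c) = ad a b \<otimes> c \<oplus> b \<otimes> ad a c"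
  by (simp add: ad_def l_distr r_distr minus_eq m_assoc l_minus r_minus a_ac r_neg1 r_neg2)

lemma minus_smult: "a \<in> carrier R \<Longrightarrow> \<ominus> (c \<odot> a) = c \<odot> (\<ominus> a)"
  using smult_mult(2)[of "\<ominus> \<one>" a c] by (simp add: smult_closed l_minus)

lemma ad_smult:
  "a \<in> carrier R \<Longrightarrow> b \<in> carrier R \<Longrightarrow> ad a (c \<odot> b) = c \<odot> ad a b"
  by (simp add: ad_def smult_mult minus_eq scalars.smult_r_distr minus_smult)

lemma ad_closed: "a \<in> carrier R \<Longrightarrow> b \<in> carrier R \<Longrightarrow> ad a b \<in> carrier R"
  by (simp add: ad_def)

text \<open>The elements \<open>a\<close> with \<open>a \<otimes> b\<close> in \<open>I\<close> form
  a left ideal, so generators suffice. The scalar part of a generator is central, hence moving the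
  generator past \<open>b\<close> costs only \<open>ad (\<iota> y) b\<close>, which lies in
  \<open>I\<close>.\<close>

lemma I_mult_N:
  assumes a: "a \<in> I" and b: "b \<in> N"
  shows "a \<otimes> b \<in> I"
proof -
  have bc: "b \<in> carrier R" using b by (rule N_closed)
  have "I \<subseteq> {a \<in> carrier R. a \<otimes> b \<in> I}"
  proof (rule I_minimal)
    show "left_ideal {a \<in> carrier R. a \<otimes> b \<in> I} R"
      using bc by (intro left_idealI) (auto simp: l_distr m_assoc I_mult)
    fix y assume y: "y \<in> m"
    have "generator y \<otimes> b = ad (\<iota> y) b \<oplus> b \<otimes> generator y"
      using bc \<iota>_closed[OF y]
      by (simp add: generator_def ad_def minus_eq l_distr r_distr l_minus r_minus smult_mult
          smult_closed a_ac r_neg1 r_neg2)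
    also have "\<dots> \<in> I"
      using b bc y by (intro I.a_closed I_mult generator_I) (auto simp: N_def)
    finally show "generator y \<in> {a \<in> carrier R. a \<otimes> b \<in> I}"
      using generator_closed[OF y] by simp
  qed
  then show ?thesis using a by auto
qed

lemma \<iota>_N: "y \<in> m \<Longrightarrow> \<iota> y \<in> N"
  using \<iota>_commutator by (auto simp: N_def ad_def \<iota>_closed)

lemma I_minus: "a \<in> I \<Longrightarrow> b \<in> I \<Longrightarrow> a \<ominus> b \<in> I"
  by (simp add: minus_eq I.a_closed I.a_inv_closed)

text \<open>In the commutator with \<open>\<iota> y\<close>, one product lies in \<open>I\<close> by
  left multiplication and the other because \<open>\<iota> y\<close> itself belongs to
  \<open>N\<close>.\<close>

lemma I_subset_N: "I \<subseteq> N"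
proof
  fix a assume a: "a \<in> I"
  then have "ad (\<iota> y) a \<in> I" if "y \<in> m" for y
    unfolding ad_def using that by (intro I_minus I_mult I_mult_N \<iota>_N \<iota>_closed)
  then show "a \<in> N" using a by (simp add: N_def I_closed)
qed

lemma N_add: "a \<in> N \<Longrightarrow> b \<in> N \<Longrightarrow> a \<oplus> b \<in> N"
  by (auto simp: N_def ad_add \<iota>_closed intro: I.a_closed)

lemma N_mult: "a \<in> N \<Longrightarrow> b \<in> N \<Longrightarrow> a \<otimes> b \<in> N"
proof -
  assume a: "a \<in> N" and b: "b \<in> N"
  have "ad (\<iota> y) (a \<otimes> b) \<in> I" if y: "y \<in> m" for y
  proof -
    have "ad (\<iota> y) a \<otimes> b \<oplus> a \<otimes> ad (\<iota> y) b \<in> I"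
      using a b y by (intro I.a_closed I_mult I_mult_N) (auto simp: N_def)
    then show ?thesis using a b y by (simp add: ad_mult \<iota>_closed N_closed)
  qed
  then show "a \<otimes> b \<in> N" using a b by (simp add: N_def)
qed

lemma N_smult: "a \<in> N \<Longrightarrow> c \<odot> a \<in> N"
  by (auto simp: N_def ad_smult \<iota>_closed smult_closed I_smult)

lemma N_one: "\<one> \<in> N"
  by (auto simp: N_def ad_def \<iota>_closed minus_eq r_neg I.zero_closed)

lemma N_zero: "\<zero> \<in> N"
  using I_subset_N I.zero_closed by auto

lemma ad_uminus: "a \<in> carrier R \<Longrightarrow> b \<in> carrier R \<Longrightarrow> ad a (\<ominus> b) = \<ominus> ad a b"
  by (simp add: ad_def minus_eq r_minus l_minus minus_add)

lemma N_uminus: "a \<in> N \<Longrightarrow> \<ominus> a \<in> N"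
  by (auto simp: N_def ad_uminus \<iota>_closed intro: I.a_inv_closed)

lemma coset_eq_iff:
  "a \<in> carrier R \<Longrightarrow> b \<in> carrier R \<Longrightarrow> I +> a = I +> b \<longleftrightarrow> a \<ominus> b \<in> I"
proof -
  assume ab: "a \<in> carrier R" "b \<in> carrier R"
  have "I +> a = I +> b \<longleftrightarrow> a \<in> I +> b"
    using I.a_rcos_self[OF ab(1)] I.a_repr_independence'[OF _ ab(2), of a] by metis
  then show ?thesis using I.a_rcos_module[OF ab(2,1)] by (simp add: minus_eq)
qed

lemma coset_zero: "I +> \<zero> = I"
  by (rule a_coset_join2[OF zero_closed I.a_subgroup I.zero_closed])

lemma mem_coset_iff: "a \<in> carrier R \<Longrightarrow> b \<in> I +> a \<longleftrightarrow> (\<exists>i\<in>I. b = i \<oplus> a)"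
  by (auto simp: a_r_coset_def')

text \<open>Operations on cosets are unions over representatives; such a union is a single coset
  once the result does not depend on the representative.\<close>

lemma coset_union:
  assumes "a \<in> carrier R" and "\<And>i. i \<in> I \<Longrightarrow> I +> g (i \<oplus> a) = C"
  shows "(\<Union>b\<in>I +> a. I +> g b) = C"
proof -
  have "I +> g b = C" if "b \<in> I +> a" for b
    using that assms by (auto simp: mem_coset_iff)
  then show ?thesis using I.a_rcos_self[OF assms(1)] by auto
qed

lemma coset_I_add: "a \<in> carrier R \<Longrightarrow> i \<in> I \<Longrightarrow> I +> (i \<oplus> a) = I +> a"
  by (subst coset_eq_iff) (auto simp: I_closed minus_eq a_assoc r_neg)

section \<open>The algebra structure on the reduction\<close>

abbreviation H where "H \<equiv> ham_reduction R \<iota> m \<chi>"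

lemma carrier_H: "carrier H = (\<lambda>a. I +> a) ` N"
proof -
  have "rcoset_ad R I (\<iota> y) (I +> a) = I \<longleftrightarrow> ad (\<iota> y) a \<in> I" if "y \<in> m" "a \<in> carrier R" for y a
  proof -
    have "rcoset_ad R I (\<iota> y) (I +> a) = I +> ad (\<iota> y) a"
      unfolding rcoset_ad_def
    proof (rule coset_union)
      fix i assume i: "i \<in> I"
      then have "ad (\<iota> y) i \<in> I" using I_subset_N that by (auto simp: N_def)
      then show "I +> (\<iota> y \<otimes> (i \<oplus> a) \<ominus> (i \<oplus> a) \<otimes> \<iota> y) = I +> ad (\<iota> y) a"
        using that i I_closed[of i] \<iota>_closed[of y]
        by (simp flip: ad_def add: ad_add coset_I_add ad_closed)
    qed fact
    also have "\<dots> = I \<longleftrightarrow> ad (\<iota> y) a \<in> I"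
      using coset_eq_iff[of "ad (\<iota> y) a" \<zero>] that ad_closed \<iota>_closed
      by (simp add: minus_eq coset_zero)
    finally show ?thesis .
  qed
  then show ?thesis
    by (auto simp: ham_reduction_def Let_def A_RCOSETS_def' N_def)
qed

lemma H_zero: "\<zero>\<^bsub>H\<^esub> = I +> \<zero>"
  by (simp add: ham_reduction_def Let_def coset_zero)

lemma H_one: "\<one>\<^bsub>H\<^esub> = I +> \<one>"
  by (simp add: ham_reduction_def Let_def)

lemma H_add: "a \<in> carrier R \<Longrightarrow> b \<in> carrier R \<Longrightarrow> (I +> a) \<oplus>\<^bsub>H\<^esub> (I +> b) = I +> (a \<oplus> b)"
  by (simp add: ham_reduction_def Let_def I.a_rcos_sum)

text \<open>Only the right factor has to represent an invariant: changing the left factor by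
  \<open>i\<close> in \<open>I\<close> changes the product by \<open>i \<otimes> b\<close>, which
  lies in \<open>I\<close> for \<open>b\<close> in \<open>N\<close>.\<close>

lemma H_mult:
  assumes "a \<in> carrier R" "b \<in> N"
  shows "(I +> a) \<otimes>\<^bsub>H\<^esub> (I +> b) = I +> (a \<otimes> b)"
proof -
  have b: "b \<in> carrier R" using assms by (simp add: N_closed)
  have "(\<Union>d\<in>I +> b. I +> ((i \<oplus> a) \<otimes> d)) = I +> (a \<otimes> b)" if i: "i \<in> I" for i
  proof (rule coset_union)
    fix j assume j: "j \<in> I"
    have "(i \<oplus> a) \<otimes> (j \<oplus> b) = ((i \<oplus> a) \<otimes> j \<oplus> i \<otimes> b) \<oplus> a \<otimes> b"
      using I_closed[OF i] I_closed[OF j] b assms(1) by (simp add: l_distr r_distr a_ac)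
    moreover have "(i \<oplus> a) \<otimes> j \<oplus> i \<otimes> b \<in> I"
      using i j assms by (intro I.a_closed I_mult I_mult_N) (auto simp: I_closed)
    ultimately show "I +> ((i \<oplus> a) \<otimes> (j \<oplus> b)) = I +> (a \<otimes> b)"
      using assms b by (simp add: coset_I_add)
  qed fact
  then have "(\<Union>d\<in>I +> b. I +> (e \<otimes> d)) = I +> (a \<otimes> b)" if "e \<in> I +> a" for e
    using that assms(1) by (auto simp: mem_coset_iff)
  then show ?thesis
    using I.a_rcos_self[OF assms(1)] by (auto simp: ham_reduction_def Let_def rcoset_mult_def)
qed

lemma H_smult:
  assumes "a \<in> carrier R"
  shows "c \<odot>\<^bsub>H\<^esub> (I +> a) = I +> (c \<odot> a)"
proof -
  have "(\<Union>b\<in>I +> a. I +> (c \<odot> b)) = I +> (c \<odot> a)"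
    using assms
    by (intro coset_union) (simp_all add: scalars.smult_r_distr I_closed coset_I_add I_smult smult_closed)
  then show ?thesis
    by (simp add: ham_reduction_def Let_def rcoset_smult_def)
qed

lemma complex_algebra_H: "complex_algebra H"
proof -
  note H_simps = carrier_H H_zero H_one H_add H_mult H_smult N_closed N_add N_mult N_smult
    N_one N_zero N_uminus
  have H: "abelian_group H"
  proof (rule abelian_groupI)
    fix a assume "a \<in> carrier H"
    then obtain x where x: "x \<in> N" "a = I +> x" by (auto simp: carrier_H)
    then have "I +> (\<ominus> x) \<in> carrier H" "(I +> (\<ominus> x)) \<oplus>\<^bsub>H\<^esub> a = \<zero>\<^bsub>H\<^esub>"
      by (simp_all add: H_simps l_neg)
    then show "\<exists>b\<in>carrier H. b \<oplus>\<^bsub>H\<^esub> a = \<zero>\<^bsub>H\<^esub>" by blast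
  qed (auto simp: H_simps a_ac)
  moreover have "monoid H"
    by (rule monoidI) (auto simp: H_simps m_assoc)
  ultimately have "ring H"
    by (rule ringI) (auto simp: H_simps l_distr r_distr)
  moreover have "module (ring_of_type_algebra :: complex ring) H"
    using cring_from_type_algebra H
    by (rule moduleI) (auto simp: ring_of_type_algebra_def H_simps smult_closed
        scalars.smult_l_distr scalars.smult_r_distr scalars.smult_assoc1)
  ultimately show ?thesis
    unfolding complex_algebra_def by (auto simp: H_simps smult_mult smult_closed)
qed

lemma H_minus:
  assumes a: "a \<in> N" and b: "b \<in> N"
  shows "(I +> a) \<ominus>\<^bsub>H\<^esub> (I +> b) = I +> (a \<ominus> b)"
proof -
  interpret H: ring H using complex_algebra_H by (simp add: complex_algebra_def)
  have "\<ominus>\<^bsub>H\<^esub> (I +> b) = I +> (\<ominus> b)"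
    using b by (intro H.minus_equality) (auto simp: carrier_H H_add H_zero N_closed N_uminus l_neg)
  then show ?thesis using a b by (simp add: H.minus_eq minus_eq H_add N_closed)
qed

end


section \<open>Dual bases for good algebras\<close>

lemma bracket_zero_left: "bracket 0 y = 0" for y :: "'g::complex_lie_algebra"
  using bracket_add_left[of 0 0 y] by simp

lemma bracket_zero_right: "bracket y 0 = 0" for y :: "'g::complex_lie_algebra"
  using bracket_add_right[of y 0 0] by simp

lemma bracket_swap: "bracket y z = - bracket z y" for y z :: "'g::complex_lie_algebra"
proof -
  have "bracket y z + bracket z y = bracket (y + z) (y + z)"
    unfolding bracket_add_left bracket_add_right by (simp add: bracket_self)
  also have "\<dots> = 0" by (rule bracket_self)
  finally show ?thesis by (simp add: eq_neg_iff_add_eq_0)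
qed

lemma bracket_sum_left: "bracket (\<Sum>s\<in>S. g s) w = (\<Sum>s\<in>S. bracket (g s) w)"
  for w :: "'g::complex_lie_algebra"
  by (induction S rule: infinite_finite_induct) (simp_all add: bracket_zero_left bracket_add_left)

text \<open>Functionals independent on \<open>W\<close> are dualized one at a time: project a
  suitable vector to the common kernel of the old functionals, normalize it, and use it to correct
  the old vectors.\<close>

lemma exists_dual_family:
  fixes \<phi> :: "'x \<Rightarrow> 'v::complex_vector \<Rightarrow> complex"
  assumes W: "complex_vector.subspace W"
    and add: "\<And>x v w. \<phi> x (v + w) = \<phi> x v + \<phi> x w"
    and scale: "\<And>x c w. \<phi> x (c *\<^sub>C w) = c * \<phi> x w"
  shows "finite S \<Longrightarrow> (\<And>c. \<forall>w\<in>W. (\<Sum>x\<in>S. c x * \<phi> x w) = 0 \<Longrightarrow> \<forall>x\<in>S. c x = 0) \<Longrightarrow>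
    \<exists>u. \<forall>x\<in>S. u x \<in> W \<and> (\<forall>y\<in>S. \<phi> y (u x) = (if x = y then 1 else 0))"
proof (induction S rule: finite_induct)
  case (insert x S)
  have zero: "\<phi> y 0 = 0" for y using scale[of y 0 0] by simp
  have diff: "\<phi> y (v - w) = \<phi> y v - \<phi> y w" for y v w
    using add[of y "v - w" w] by simp
  have sum: "\<phi> y (\<Sum>z\<in>T. g z) = (\<Sum>z\<in>T. \<phi> y (g z))" for y g and T :: "'x set"
    by (induction T rule: infinite_finite_induct) (simp_all add: zero add)
  have "\<forall>y\<in>S. c y = 0" if c: "\<forall>w\<in>W. (\<Sum>y\<in>S. c y * \<phi> y w) = 0" for c
  proof -
    have "(\<Sum>y\<in>S. (c(x := 0)) y * \<phi> y w) = (\<Sum>y\<in>S. c y * \<phi> y w)" for w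
      using insert.hyps by (intro sum.cong) auto
    then have "\<forall>y\<in>insert x S. (c(x := 0)) y = 0"
      using c insert.hyps by (intro insert.prems) simp
    then show ?thesis using insert.hyps(2) by (metis fun_upd_other insertCI)
  qed
  from insert.IH[OF this] obtain u
    where u: "\<And>y. y \<in> S \<Longrightarrow> u y \<in> W"
      "\<And>y z. y \<in> S \<Longrightarrow> z \<in> S \<Longrightarrow> \<phi> z (u y) = (if y = z then 1 else 0)" by blast
  \<comment> \<open>With these coefficients the combination evaluates at \<open>w\<close> to
    \<open>\<phi> x w1\<close>, where \<open>w1\<close> is the projection of \<open>w\<close>
    defined below. The coefficient 1 at \<open>x\<close> makes the relation nontrivial.\<close>
  define c where "c y = (if y = x then 1 else - \<phi> x (u y))" for y
  have "\<not> (\<forall>w\<in>W. (\<Sum>y\<in>insert x S. c y * \<phi> y w) = 0)"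
    using insert.prems[of c] by (auto simp: c_def)
  then obtain w where w: "w \<in> W" "(\<Sum>y\<in>insert x S. c y * \<phi> y w) \<noteq> 0" by blast
  define w1 where "w1 = w - (\<Sum>y\<in>S. \<phi> y w *\<^sub>C u y)"
  have w1: "w1 \<in> W" unfolding w1_def using w(1) u(1) W
    by (intro complex_vector.subspace_diff complex_vector.subspace_sum complex_vector.subspace_scale)
  have w1_S: "\<phi> y w1 = 0" if "y \<in> S" for y
  proof -
    have "(\<Sum>z\<in>S. \<phi> z w * \<phi> y (u z)) = (\<Sum>z\<in>S. if z = y then \<phi> z w else 0)"
      using u(2) that by (intro sum.cong) auto
    then show ?thesis using that insert.hyps by (simp add: w1_def diff sum scale)
  qed
  have "(\<Sum>y\<in>S. c y * \<phi> y w) = - (\<Sum>y\<in>S. \<phi> y w * \<phi> x (u y))"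
    using insert.hyps by (simp add: c_def mult.commute flip: sum_negf) (intro sum.cong; auto)
  then have "\<phi> x w1 = (\<Sum>y\<in>insert x S. c y * \<phi> y w)"
    using insert.hyps by (simp add: w1_def diff sum scale c_def)
  then have w1_x: "\<phi> x w1 \<noteq> 0" using w(2) by simp
  define ux where "ux = inverse (\<phi> x w1) *\<^sub>C w1"
  have ux: "ux \<in> W" "\<phi> x ux = 1" "\<And>y. y \<in> S \<Longrightarrow> \<phi> y ux = 0"
    using w1 w1_x w1_S W by (auto simp: ux_def scale intro: complex_vector.subspace_scale)
  define u' where "u' y = (if y = x then ux else u y - \<phi> x (u y) *\<^sub>C ux)" for y
  have "u' y \<in> W" if "y \<in> insert x S" for y
    unfolding u'_def using that ux u W
    by (auto intro: complex_vector.subspace_diff complex_vector.subspace_scale)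
  moreover have "\<phi> z (u' y) = (if y = z then 1 else 0)" if "y \<in> insert x S" "z \<in> insert x S" for y z
    using that ux u insert.hyps by (auto simp: u'_def diff scale)
  ultimately show ?case by blast
qed simp

section \<open>Invariant forms and good gradings\<close>

locale graded_form =
  fixes \<beta> :: "'g::complex_lie_algebra \<Rightarrow> 'g \<Rightarrow> complex" and f q :: 'g and \<Gamma> :: "int \<Rightarrow> 'g set"
  assumes finite_dimensional: "finite_dimensional TYPE('g)"
    and form: "invariant_form \<beta>"
    and good_grading: "good_grading f \<Gamma>"
    and grading_element: "grading_element q \<Gamma>"
begin

lemma \<beta>_add: "\<beta> (y + z) w = \<beta> y w + \<beta> z w" "\<beta> w (y + z) = \<beta> w y + \<beta> w z"
  and \<beta>_scale: "\<beta> (c *\<^sub>C y) w = c * \<beta> y w" "\<beta> w (c *\<^sub>C y) = c * \<beta> w y"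
  and \<beta>_sym: "\<beta> y z = \<beta> z y"
  and \<beta>_bracket: "\<beta> (bracket y z) w = \<beta> y (bracket z w)"
  and \<beta>_nondegenerate: "(\<And>z. \<beta> y z = 0) \<Longrightarrow> y = 0"
  using form unfolding invariant_form_def by metis+

lemma \<beta>_zero: "\<beta> 0 w = 0" "\<beta> w 0 = 0"
  using \<beta>_add(1)[of 0 0 w] \<beta>_add(2)[of w 0 0] by simp_all

lemma \<beta>_minus: "\<beta> (- y) w = - \<beta> y w"
  using \<beta>_add(1)[of y "- y" w] by (simp add: \<beta>_zero eq_neg_iff_add_eq_0 add.commute)

lemma \<beta>_sum: "\<beta> (\<Sum>s\<in>S. g s) w = (\<Sum>s\<in>S. \<beta> (g s) w)"
  by (induction S rule: infinite_finite_induct) (simp_all add: \<beta>_zero \<beta>_add)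

lemma grading: "lie_grading \<Gamma>" and f_\<Gamma>: "f \<in> \<Gamma> (- 2)"
  and inj_on_f: "k \<ge> 1 \<Longrightarrow> inj_on (bracket f) (\<Gamma> k)"
  using good_grading by (auto simp: good_grading_def)

lemma subspace_\<Gamma>: "complex_vector.subspace (\<Gamma> k)"
  and bracket_\<Gamma>: "y \<in> \<Gamma> k \<Longrightarrow> z \<in> \<Gamma> l \<Longrightarrow> bracket y z \<in> \<Gamma> (k + l)"
  using grading by (auto simp: lie_grading_def)

lemma span_\<Gamma>: "complex_vector.span (\<Union>k. \<Gamma> k) = UNIV"
proof -
  have "y \<in> complex_vector.span (\<Union>k. \<Gamma> k)" for y
  proof -
    obtain v where v: "\<forall>k. v k \<in> \<Gamma> k" "y = (\<Sum>k | v k \<noteq> 0. v k)"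
      using grading unfolding lie_grading_def by metis
    show ?thesis
      unfolding v(2) using v(1) by (intro complex_vector.span_sum complex_vector.span_base) auto
  qed
  then show ?thesis by auto
qed

text \<open>Invariance makes \<open>bracket q\<close> skew for \<beta>, so its eigenvalues on two
  vectors that pair nontrivially add up to 0.\<close>

lemma \<beta>_orthogonal: "y \<in> \<Gamma> k \<Longrightarrow> z \<in> \<Gamma> l \<Longrightarrow> k + l \<noteq> 0 \<Longrightarrow> \<beta> y z = 0"
proof -
  assume y: "y \<in> \<Gamma> k" and z: "z \<in> \<Gamma> l" and kl: "k + l \<noteq> 0"
  have "of_int k * \<beta> y z = \<beta> (bracket q y) z"
    using y grading_element by (simp add: grading_element_def \<beta>_scale)
  also have "\<dots> = - \<beta> y (bracket q z)"
    by (subst bracket_swap) (simp add: \<beta>_minus \<beta>_bracket)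
  also have "\<dots> = - (of_int l * \<beta> y z)"
    using z grading_element by (simp add: grading_element_def \<beta>_scale)
  finally have "of_int (k + l) * \<beta> y z = 0" by (simp add: distrib_right)
  then show ?thesis using kl by (metis mult_eq_0_iff of_int_eq_0_iff)
qed

lemma \<beta>_nondegenerate_\<Gamma>:
  assumes y: "y \<in> \<Gamma> k" and orth: "\<And>z. z \<in> \<Gamma> (- k) \<Longrightarrow> \<beta> y z = 0"
  shows "y = 0"
proof (rule \<beta>_nondegenerate)
  fix z
  have "z \<in> complex_vector.span (\<Union>k. \<Gamma> k)" by (simp add: span_\<Gamma>)
  then show "\<beta> y z = 0"
  proof (induction rule: complex_vector.span_induct_alt)
    case (step c z w)
    then obtain l where "z \<in> \<Gamma> l" by blast
    then have "\<beta> y z = 0"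
      using \<beta>_orthogonal[OF y, of z l] orth[of z] by (cases "l = - k") auto
    then show ?case using step by (simp add: \<beta>_add \<beta>_scale)
  qed (simp add: \<beta>_zero)
qed

lemma \<chi>_\<Gamma>: "y \<in> \<Gamma> k \<Longrightarrow> k \<noteq> 2 \<Longrightarrow> \<beta> f y = 0"
  by (rule \<beta>_orthogonal[OF f_\<Gamma>]) auto

text \<open>By invariance the pairing of \<open>y\<close> with \<open>w\<close> is \<beta>([f, y],
  w). Its vanishing gives [f, y] = 0, and \<open>bracket f\<close> is injective in positive
  degrees.\<close>

lemma \<chi>_nondegenerate:
  assumes y: "y \<in> \<Gamma> k" and k: "k \<ge> 1" and orth: "\<And>w. w \<in> \<Gamma> (2 - k) \<Longrightarrow> \<beta> f (bracket y w) = 0"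
  shows "y = 0"
proof -
  have "bracket f y = 0"
  proof (rule \<beta>_nondegenerate_\<Gamma>)
    show "bracket f y \<in> \<Gamma> (- 2 + k)" using f_\<Gamma> y by (rule bracket_\<Gamma>)
  qed (use orth in \<open>auto simp: \<beta>_bracket\<close>)
  then show ?thesis
    using inj_onD[OF inj_on_f[OF k], of y 0] y subspace_\<Gamma> 
    by (simp add: bracket_zero_right complex_vector.subspace_0)
qed

text \<open>The terms of degree other than k add up to an element of \<open>\<Gamma> k\<close> that
  is orthogonal to \<open>\<Gamma> (- k)\<close>, hence to 0.\<close>

lemma homogeneous_in_span:
  assumes S: "finite S" "\<And>x. x \<in> S \<Longrightarrow> x \<in> \<Gamma> (e x)"
    and y: "y \<in> \<Gamma> k" "y \<in> complex_vector.span S"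
  shows "y \<in> complex_vector.span {x \<in> S. e x = k}"
proof -
  obtain c where c: "y = (\<Sum>x\<in>S. c x *\<^sub>C x)"
    using y(2) S(1) by (auto simp: complex_vector.span_finite)
  let ?T = "{x \<in> S. e x = k}"
  have split: "y = (\<Sum>x\<in>?T. c x *\<^sub>C x) + (\<Sum>x\<in>S - ?T. c x *\<^sub>C x)"
    unfolding c using S(1) sum.subset_diff[of ?T S "\<lambda>x. c x *\<^sub>C x"] by (simp add: add.commute)
  let ?z = "\<Sum>x\<in>S - ?T. c x *\<^sub>C x"
  have "?z = y - (\<Sum>x\<in>?T. c x *\<^sub>C x)"
    by (subst split) simp
  also have "\<dots> \<in> \<Gamma> k"
    using y S(2) subspace_\<Gamma>
    by (intro complex_vector.subspace_diff complex_vector.subspace_sum complex_vector.subspace_scale) auto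
  finally have "?z \<in> \<Gamma> k" .
  then have "?z = 0"
  proof (rule \<beta>_nondegenerate_\<Gamma>)
    fix w assume w: "w \<in> \<Gamma> (- k)"
    have "\<beta> x w = 0" if "x \<in> S - ?T" for x
      using that \<beta>_orthogonal[OF S(2) w] by auto
    then show "\<beta> ?z w = 0" by (simp add: \<beta>_sum \<beta>_scale)
  qed
  then have "y = (\<Sum>x\<in>?T. c x *\<^sub>C x)" using split by simp
  then show ?thesis
    by (auto intro: complex_vector.span_sum complex_vector.span_scale complex_vector.span_base)
qed

text \<open>Two elements of the Lagrangian subspace pair to 0. Any other pair of homogeneous
  generators has a bracket of degree at least 3, where \<chi> vanishes.\<close>

lemma good_algebra_character:
  assumes m: "good_algebra \<beta> f \<Gamma> m" and y: "y \<in> m" and z: "z \<in> m"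
  shows "\<beta> f (bracket y z) = 0"
proof -
  obtain l where l: "l = {x \<in> \<Gamma> 1. \<forall>y\<in>l. \<beta> f (bracket x y) = 0}"
    and m_eq: "m = complex_vector.span (l \<union> (\<Union>i\<in>{2..}. \<Gamma> i))"
    using m unfolding good_algebra_def lagrangian_def by blast
  let ?H = "l \<union> (\<Union>i\<in>{2..}. \<Gamma> i)"
  have l1: "l \<subseteq> \<Gamma> 1" using l by blast
  have degree: "\<exists>i\<ge>1. c \<in> \<Gamma> i \<and> (c \<notin> l \<longrightarrow> i \<ge> 2)" if c: "c \<in> ?H" for c
  proof (cases "c \<in> l")
    case True
    then show ?thesis using l1 by (intro exI[of _ 1]) auto
  next
    case False
    then obtain i where "i \<ge> 2" "c \<in> \<Gamma> i" using c by auto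
    then show ?thesis by (intro exI[of _ i]) auto
  qed
  have H: "\<beta> f (bracket a b) = 0" if a: "a \<in> ?H" and b: "b \<in> ?H" for a b
  proof (cases "a \<in> l \<and> b \<in> l")
    case True
    then show ?thesis using l by blast
  next
    case False
    obtain i j where "a \<in> \<Gamma> i" "b \<in> \<Gamma> j" "i \<ge> 1" "j \<ge> 1" "i \<ge> 2 \<or> j \<ge> 2"
      using degree[OF a] degree[OF b] False by blast
    then show ?thesis using \<chi>_\<Gamma>[OF bracket_\<Gamma>] by auto
  qed
  have "\<beta> f (bracket a z) = 0" if a: "a \<in> ?H" for a
    using z unfolding m_eq
  proof (induction rule: complex_vector.span_induct_alt)
    case (step c b b')
    then show ?case using H[OF a] by (simp add: bracket_add_right bracket_scale_right \<beta>_add \<beta>_scale)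
  qed (simp add: bracket_zero_right \<beta>_zero)
  note * = this
  show ?thesis
    using y unfolding m_eq
  proof (induction rule: complex_vector.span_induct_alt)
    case (step c a a')
    then show ?case using * by (simp add: bracket_add_left bracket_scale_left \<beta>_add \<beta>_scale)
  qed (simp add: bracket_zero_left \<beta>_zero)
qed

lemma finite_independent:
  fixes S :: "'g set"
  assumes "complex_vector.independent S"
  shows "finite S"
proof -
  obtain B :: "'g set" where "finite B" "complex_vector.span B = UNIV"
    using finite_dimensional by (auto simp: finite_dimensional_def)
  then show ?thesis
    using complex_vector.independent_span_bound[of B S] assms by simp
qed

text \<open>Choose a basis of \<open>m\<close> among its homogeneous generators and dualize it
  degree by degree. Across different degrees the pairing vanishes, since then the bracket does not
  have degree 2.\<close>

lemma exists_dual_bases: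
  assumes m: "good_algebra \<beta> f \<Gamma> m"
  shows "\<exists>r x u d. dual_bases (\<beta> f) \<Gamma> r x u d \<and> m = complex_vector.span (x ` {..<r})"
proof -
  obtain l where l: "l \<subseteq> \<Gamma> 1" and m_eq: "m = complex_vector.span (l \<union> (\<Union>i\<in>{2..}. \<Gamma> i))"
    using m unfolding good_algebra_def lagrangian_def by blast
  let ?H = "l \<union> (\<Union>i\<in>{2..}. \<Gamma> i)"
  obtain S where S: "S \<subseteq> ?H" "complex_vector.independent S" "?H \<subseteq> complex_vector.span S"
    using complex_vector.maximal_independent_subset[of ?H] by blast
  have finS: "finite S" using S(2) by (rule finite_independent)
  have m_span: "m = complex_vector.span S"
    unfolding m_eq using S by (metis complex_vector.span_eq complex_vector.span_superset subset_trans)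
  have "\<forall>x\<in>S. \<exists>k\<ge>1. x \<in> \<Gamma> k"
  proof
    fix x assume "x \<in> S"
    then consider "x \<in> \<Gamma> 1" | i where "i \<ge> 2" "x \<in> \<Gamma> i" using S(1) l by auto
    then show "\<exists>k\<ge>1. x \<in> \<Gamma> k"
    proof cases
      case (2 i)
      then show ?thesis by (intro exI[of _ i]) simp
    qed auto
  qed
  then obtain e where e: "\<And>x. x \<in> S \<Longrightarrow> e x \<ge> 1" "\<And>x. x \<in> S \<Longrightarrow> x \<in> \<Gamma> (e x)"
    by metis
  have "\<exists>u. \<forall>x\<in>{x \<in> S. e x = k}. u x \<in> \<Gamma> (2 - k) \<and>
      (\<forall>y\<in>{x \<in> S. e x = k}. \<beta> f (bracket y (u x)) = (if x = y then 1 else 0))" (is "\<exists>u. ?P k u") for k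
  proof (rule exists_dual_family)
    fix c
    assume c: "\<forall>w\<in>\<Gamma> (2 - k). (\<Sum>x\<in>{x \<in> S. e x = k}. c x * \<beta> f (bracket x w)) = 0"
    let ?y = "\<Sum>x\<in>{x \<in> S. e x = k}. c x *\<^sub>C x"
    show "\<forall>x\<in>{x \<in> S. e x = k}. c x = 0"
    proof (cases "k \<ge> 1")
      case True
      have "?y \<in> \<Gamma> k"
        using e by (intro complex_vector.subspace_sum complex_vector.subspace_scale subspace_\<Gamma>) auto
      moreover have "\<beta> f (bracket ?y w) = (\<Sum>x\<in>{x \<in> S. e x = k}. c x * \<beta> f (bracket x w))" for w
        by (simp add: bracket_sum_left bracket_scale_left \<beta>_sym[of f] \<beta>_sum \<beta>_scale)
      ultimately have "?y = 0" using True c by (intro \<chi>_nondegenerate) auto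
      then show ?thesis
        using complex_vector.independentD[OF S(2), of "{x \<in> S. e x = k}" c] finS by auto
    next
      case False
      then show ?thesis using e by fastforce
    qed
  qed (auto simp: finS subspace_\<Gamma> bracket_add_right bracket_scale_right \<beta>_add \<beta>_scale)
  then have "\<forall>k. \<exists>u. ?P k u" by (rule allI)
  from choice[OF this] obtain U where U: "\<forall>k. ?P k (U k)" ..
  define u where "u x = U (e x) x" for x
  have u_\<Gamma>: "u x \<in> \<Gamma> (2 - e x)" if "x \<in> S" for x
    using U that by (auto simp: u_def)
  have dual: "\<beta> f (bracket y (u x)) = (if y = x then 1 else 0)" if "x \<in> S" "y \<in> S" for x y
  proof (cases "e y = e x")
    case True
    then show ?thesis using spec[OF U, of "e x"] that by (auto simp: u_def)
  next
    case False
    then have "\<beta> f (bracket y (u x)) = 0"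
      using \<chi>_\<Gamma>[OF bracket_\<Gamma>[OF e(2)[OF that(2)] u_\<Gamma>[OF that(1)]]] by simp
    then show ?thesis using False by auto
  qed
  \<comment> \<open>Negating the key lists the degrees in decreasing order, as
    \<open>d_antimono\<close> demands.\<close>
  define xs where "xs = sort_key (\<lambda>x. - e x) (SOME xs. set xs = S \<and> distinct xs)"
  have "set (SOME xs. set xs = S \<and> distinct xs) = S \<and> distinct (SOME xs. set xs = S \<and> distinct xs)"
    using finite_distinct_list[OF finS] by (rule someI_ex)
  then have xs: "set xs = S" "distinct xs" by (simp_all add: xs_def)
  have sorted: "sorted (map (\<lambda>x. - e x) xs)" by (simp add: xs_def)
  have nth_S: "xs ! i \<in> S" if "i < length xs" for i
    using that xs(1) nth_mem by blast
  have layer: "{xs ! i | i. i < length xs \<and> e (xs ! i) = k} = {x \<in> S. e x = k}" for k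
    using xs(1) by (auto simp: in_set_conv_nth)
  have "dual_bases (\<beta> f) \<Gamma> (length xs) ((!) xs) (\<lambda>i. u (xs ! i)) (\<lambda>i. e (xs ! i))"
  proof
    fix k :: int assume k: "2 \<le> k"
    show "\<Gamma> k \<subseteq> complex_vector.span {xs ! i | i. i < length xs \<and> e (xs ! i) = k}"
      unfolding layer
    proof
      fix y assume "y \<in> \<Gamma> k"
      moreover have "y \<in> complex_vector.span S" using \<open>y \<in> \<Gamma> k\<close> k S(3) by auto
      ultimately show "y \<in> complex_vector.span {x \<in> S. e x = k}"
        using finS e(2) by (intro homogeneous_in_span) auto
    qed
  next
    fix i j assume "i \<le> j" "j < length xs"
    then show "e (xs ! j) \<le> e (xs ! i)"
      using sorted_nth_mono[OF sorted, of i j] by simp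
  next
    fix i j assume "i < length xs" "j < length xs"
    then show "\<beta> f (bracket (xs ! i) (u (xs ! j))) = (if i = j then 1 else 0)"
      using dual nth_S xs(2) by (simp add: nth_eq_iff_index_eq)
  next
    fix i j assume "i < length xs" "j < length xs"
    then show "\<beta> f (bracket (xs ! i) (xs ! j)) = 0"
      using nth_S by (intro good_algebra_character[OF m]) (auto simp: m_span complex_vector.span_base)
  qed (auto simp: span_\<Gamma> subspace_\<Gamma> bracket_\<Gamma> \<beta>_add \<beta>_scale \<chi>_\<Gamma> nth_S e u_\<Gamma>)
  moreover have "(!) xs ` {..<length xs} = S"
    using xs(1) by (auto simp: in_set_conv_nth)
  ultimately show ?thesis using m_span by metis
qed

end


section \<open>Reduction by stages\<close>

lemma uea_algebra_simps [simp]: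
  "carrier uea_algebra = UNIV" "a \<otimes>\<^bsub>uea_algebra\<^esub> b = a * b" "a \<oplus>\<^bsub>uea_algebra\<^esub> b = a + b"
  "\<one>\<^bsub>uea_algebra\<^esub> = 1" "\<zero>\<^bsub>uea_algebra\<^esub> = 0" "c \<odot>\<^bsub>uea_algebra\<^esub> a = c *\<^sub>C a"
  by (simp_all add: uea_algebra_def)

lemma complex_algebra_uea: "complex_algebra (uea_algebra :: (complex, 'g::complex_lie_algebra uea) module)"
proof -
  have grp: "abelian_group (uea_algebra :: (complex, 'g uea) module)"
    by (rule abelian_groupI) (auto simp: add_ac intro: exI[of _ "- x" for x])
  moreover have "monoid (uea_algebra :: (complex, 'g uea) module)"
    by (rule monoidI) (auto simp: mult.assoc)
  ultimately have "ring (uea_algebra :: (complex, 'g uea) module)"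
    by (rule ringI) (auto simp: distrib_left distrib_right)
  moreover have "module (ring_of_type_algebra :: complex ring) (uea_algebra :: (complex, 'g uea) module)"
    using cring_from_type_algebra grp
    by (rule moduleI) (auto simp: ring_of_type_algebra_def scaleC_add_left scaleC_add_right
        scaleC_scaleC scaleC_one)
  ultimately show ?thesis
    by (simp add: complex_algebra_def uea_scale_mult_left uea_scale_mult_right)
qed

lemma uea_algebra_minus [simp]: "a \<ominus>\<^bsub>uea_algebra\<^esub> b = a - b"
proof -
  interpret ring "uea_algebra :: (complex, 'a uea) module"
    by (rule conjunct1[OF complex_algebra_uea[unfolded complex_algebra_def]])
  have "\<ominus>\<^bsub>uea_algebra\<^esub> b = - b" by (rule minus_equality) auto
  then show ?thesis by (simp add: minus_eq)
qed

text \<open>A commutator of generators is the image of a bracket, and this is an unshifted ideal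
  generator because \<chi> vanishes on brackets.\<close>

lemma uea_hamiltonian:
  assumes m: "lie_subalgebra m" and \<chi>: "\<And>y z. y \<in> m \<Longrightarrow> z \<in> m \<Longrightarrow> \<chi> (bracket y z) = 0"
  shows "hamiltonian uea_algebra uea_incl m \<chi>"
proof
  fix y z assume yz: "y \<in> m" "z \<in> m"
  let ?gen = "\<lambda>y. uea_incl y \<ominus>\<^bsub>uea_algebra\<^esub> (\<chi> y \<odot>\<^bsub>uea_algebra\<^esub> \<one>\<^bsub>uea_algebra\<^esub>)"
  have "?gen ` m \<subseteq> shift_ideal uea_algebra uea_incl m \<chi>"
    unfolding shift_ideal_def
    using complex_algebra_uea by (intro left_ideal_gen(2)) (auto simp: complex_algebra_def)
  moreover have "bracket y z \<in> m" using m yz by (simp add: lie_subalgebra_def)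
  ultimately have "?gen (bracket y z) \<in> shift_ideal uea_algebra uea_incl m \<chi>" by blast
  then show "uea_incl y \<otimes>\<^bsub>uea_algebra\<^esub> uea_incl z \<ominus>\<^bsub>uea_algebra\<^esub> uea_incl z \<otimes>\<^bsub>uea_algebra\<^esub> uea_incl y
      \<in> shift_ideal uea_algebra uea_incl m \<chi>"
    by (simp add: \<chi>[OF yz] uea_incl_bracket)
qed (simp_all add: complex_algebra_uea)

section \<open>The ideals of \<open>m\<^sub>1\<close> and \<open>m\<^sub>2\<close> and their
  Whittaker vectors\<close>

locale two_stages = dual_bases \<chi>\<^sub>1 \<Gamma> r x u d
  for \<chi>\<^sub>1 :: "'g::complex_lie_algebra \<Rightarrow> complex" and \<Gamma> r x u d +
  fixes \<chi>\<^sub>2 :: "'g \<Rightarrow> complex" and m\<^sub>0 m\<^sub>1 m\<^sub>2 :: "'g set"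
  assumes m1_span: "m\<^sub>1 = complex_vector.span (x ` {..<r})"
    and m0: "lie_subalgebra m\<^sub>0" and m1_ideal: "lie_ideal_in m\<^sub>1 m\<^sub>2"
    and m2_eq: "m\<^sub>2 = {y + z | y z. y \<in> m\<^sub>1 \<and> z \<in> m\<^sub>0}"
    and \<chi>2_add: "\<chi>\<^sub>2 (y + z) = \<chi>\<^sub>2 y + \<chi>\<^sub>2 z"
    and \<chi>2_eq: "y \<in> m\<^sub>1 \<Longrightarrow> \<chi>\<^sub>2 y = \<chi>\<^sub>1 y"
    and \<chi>2_bracket: "y \<in> m\<^sub>2 \<Longrightarrow> z \<in> m\<^sub>2 \<Longrightarrow> \<chi>\<^sub>2 (bracket y z) = 0"
begin

lemma m1_subspace: "complex_vector.subspace m\<^sub>1" and m0_subspace: "complex_vector.subspace m\<^sub>0"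
  and bracket_m2_m1: "y \<in> m\<^sub>2 \<Longrightarrow> z \<in> m\<^sub>1 \<Longrightarrow> bracket y z \<in> m\<^sub>1"
  and m1_m2: "m\<^sub>1 \<subseteq> m\<^sub>2"
  using m0 m1_ideal by (auto simp: lie_subalgebra_def lie_ideal_in_def)

lemma m0_m2: "m\<^sub>0 \<subseteq> m\<^sub>2"
proof
  fix y assume "y \<in> m\<^sub>0"
  then have "y = 0 + y \<and> 0 \<in> m\<^sub>1 \<and> y \<in> m\<^sub>0"
    using m1_subspace by (simp add: complex_vector.subspace_0)
  then show "y \<in> m\<^sub>2" unfolding m2_eq by blast
qed

lemma bracket_m1_m2: "y \<in> m\<^sub>1 \<Longrightarrow> z \<in> m\<^sub>2 \<Longrightarrow> bracket y z \<in> m\<^sub>1"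
  using bracket_m2_m1[of z y] m1_subspace bracket_swap[of y z]
  by (simp add: complex_vector.subspace_neg)

lemma m2_subspace: "complex_vector.subspace m\<^sub>2"
  unfolding m2_eq by (rule complex_vector.subspace_sums[OF m1_subspace m0_subspace])

lemma m1: "lie_subalgebra m\<^sub>1"
  using m1_subspace m1_m2 bracket_m2_m1 by (auto simp: lie_subalgebra_def)

lemma m2: "lie_subalgebra m\<^sub>2"
  unfolding lie_subalgebra_def
proof (intro conjI ballI)
  fix y z assume y: "y \<in> m\<^sub>2" and z: "z \<in> m\<^sub>2"
  obtain y1 y0 where y': "y = y1 + y0" "y1 \<in> m\<^sub>1" "y0 \<in> m\<^sub>0" using y m2_eq by blast
  obtain z1 z0 where z': "z = z1 + z0" "z1 \<in> m\<^sub>1" "z0 \<in> m\<^sub>0" using z m2_eq by blast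
  have "bracket y z = bracket y z1 + (bracket y1 z0 + bracket y0 z0)"
    by (simp add: y' z' bracket_add_left bracket_add_right)
  moreover have "bracket y z1 \<in> m\<^sub>2" "bracket y1 z0 \<in> m\<^sub>2" "bracket y0 z0 \<in> m\<^sub>2"
    using bracket_m2_m1[OF y z'(2)] bracket_m1_m2[OF y'(2), of z0] m1_m2 m0_m2 m0 y' z'
    by (auto simp: lie_subalgebra_def)
  ultimately show "bracket y z \<in> m\<^sub>2"
    using m2_subspace by (simp add: complex_vector.subspace_add)
qed (rule m2_subspace)

sublocale H1: hamiltonian uea_algebra uea_incl m\<^sub>1 \<chi>\<^sub>1
proof (rule uea_hamiltonian[OF m1])
  fix y z assume yz: "y \<in> m\<^sub>1" "z \<in> m\<^sub>1"
  then have "bracket y z \<in> m\<^sub>1" using m1 by (simp add: lie_subalgebra_def)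
  then show "\<chi>\<^sub>1 (bracket y z) = 0" using \<chi>2_bracket[of y z] yz m1_m2 by (auto simp flip: \<chi>2_eq)
qed

sublocale H2: hamiltonian uea_algebra uea_incl m\<^sub>2 \<chi>\<^sub>2
  by (rule uea_hamiltonian[OF m2]) (rule \<chi>2_bracket)

lemma H1_generator: "H1.generator = shifted \<chi>\<^sub>1" and H2_generator: "H2.generator = shifted \<chi>\<^sub>2"
  by (simp_all add: fun_eq_iff H1.generator_def H2.generator_def shifted_def)

lemma ad_eq: "H1.ad a b = a * b - b * a" "H2.ad a b = a * b - b * a"
  by (simp_all add: H1.ad_def H2.ad_def)

lemma I1_zero: "0 \<in> H1.I" and I1_add: "a \<in> H1.I \<Longrightarrow> b \<in> H1.I \<Longrightarrow> a + b \<in> H1.I"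
  and I1_mult: "b \<in> H1.I \<Longrightarrow> a * b \<in> H1.I"
  using H1.I.zero_closed H1.I.a_closed H1.I_mult by auto

lemma I2_zero: "0 \<in> H2.I" and I2_add: "a \<in> H2.I \<Longrightarrow> b \<in> H2.I \<Longrightarrow> a + b \<in> H2.I"
  and I2_mult: "b \<in> H2.I \<Longrightarrow> a * b \<in> H2.I"
  using H2.I.zero_closed H2.I.a_closed H2.I_mult by auto

sublocale K1: whittaker_ideal \<chi>\<^sub>1 \<Gamma> r x u d H1.I
  by standard (use I1_zero I1_add I1_mult in auto)

text \<open>The same bases and the same \<chi> are used modulo the larger ideal. This gives
  independence of the monomials there as well.\<close>

sublocale K2: whittaker_ideal \<chi>\<^sub>1 \<Gamma> r x u d H2.I
  by standard (use I2_zero I2_add I2_mult in auto)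

lemma I1_I2: "H1.I \<subseteq> H2.I"
proof (rule H1.I_minimal[OF H2.left_ideal_I])
  fix y assume "y \<in> m\<^sub>1"
  then show "H1.generator y \<in> H2.I"
    using H2.generator_I[of y] m1_m2 \<chi>2_eq[of y] by (auto simp: H1_generator H2_generator shifted_def)
qed

lemma whittaker_commutator:
  "shifted \<chi> y * a = (uea_incl y * a - a * uea_incl y) + a * shifted \<chi> y"
  by (simp add: shifted_def algebra_simps uea_scale_mult_left uea_scale_mult_right)

text \<open>The commutator and the left product differ by
  \<open>a * shifted \<chi>\<^sub>1 y\<close>, which lies in the left ideal. So invariants are
  Whittaker vectors.\<close>

lemma commutator_I1_iff: "y \<in> m\<^sub>1 \<Longrightarrow> uea_incl y * a - a * uea_incl y \<in> H1.I \<longleftrightarrow> shifted \<chi>\<^sub>1 y * a \<in> H1.I"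
  using H1.generator_I[of y] K1.I_mult[of "shifted \<chi>\<^sub>1 y" a] K1.I_add K1.I_diff
  unfolding whittaker_commutator[of \<chi>\<^sub>1 y a] H1_generator by (metis add_diff_cancel_right')

lemma commutator_I2_iff: "y \<in> m\<^sub>1 \<Longrightarrow> uea_incl y * a - a * uea_incl y \<in> H2.I \<longleftrightarrow> shifted \<chi>\<^sub>1 y * a \<in> H2.I"
  using H1.generator_I[of y] I1_I2 K2.I_mult[of "shifted \<chi>\<^sub>1 y" a] K2.I_add K2.I_diff
  unfolding whittaker_commutator[of \<chi>\<^sub>1 y a] H1_generator by (metis add_diff_cancel_right' subsetD)

lemma x_m1: "i < r \<Longrightarrow> x i \<in> m\<^sub>1"
  unfolding m1_span by (rule complex_vector.span_base) auto

lemma N1_iff: "a \<in> H1.N \<longleftrightarrow> (\<forall>y\<in>m\<^sub>1. uea_incl y * a - a * uea_incl y \<in> H1.I)"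
  and N2_iff: "a \<in> H2.N \<longleftrightarrow> (\<forall>y\<in>m\<^sub>2. uea_incl y * a - a * uea_incl y \<in> H2.I)"
  by (simp_all add: H1.N_def H2.N_def ad_eq)

lemma whittaker_eq_N1: "K1.whittaker = H1.N"
proof
  show "H1.N \<subseteq> K1.whittaker"
    using x_m1 commutator_I1_iff by (auto simp: N1_iff K1.whittaker_def)
  show "K1.whittaker \<subseteq> H1.N"
  proof
    fix a assume a: "a \<in> K1.whittaker"
    have "shifted \<chi>\<^sub>1 y * a \<in> H1.I" if "y \<in> m\<^sub>1" for y
    proof -
      have "y \<in> complex_vector.span (x ` {..<r})" using that by (simp add: m1_span)
      then show ?thesis
        by (rule shifted_span_induct)
          (use a in \<open>auto simp: K1.whittaker_def intro: K1.I_zero K1.I_add K1.I_scale\<close>)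
    qed
    then show "a \<in> H1.N" by (simp add: N1_iff commutator_I1_iff)
  qed
qed

lemma N1_whittaker2: "H1.N \<subseteq> K2.whittaker"
  using I1_I2 by (auto simp: K1.whittaker_def K2.whittaker_def simp flip: whittaker_eq_N1)

lemma N2_whittaker2: "H2.N \<subseteq> K2.whittaker"
proof
  fix a assume a: "a \<in> H2.N"
  have "shifted \<chi>\<^sub>1 (x i) * a \<in> H2.I" if "i < r" for i
    using a x_m1[OF that] m1_m2 by (subst commutator_I2_iff[symmetric]) (auto simp: N2_iff)
  then show "a \<in> K2.whittaker" by (simp add: K2.whittaker_def)
qed

text \<open>As \<open>m\<^sub>1\<close> is an ideal of \<open>m\<^sub>2\<close>, the bracket stays
  in \<open>m\<^sub>1\<close>. The character vanishes on it, so the commutator is a generator of the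
  first ideal.\<close>

lemma incl_m0_N1: "y \<in> m\<^sub>0 \<Longrightarrow> uea_incl y \<in> H1.N"
  unfolding N1_iff
proof
  fix z assume y: "y \<in> m\<^sub>0" and z: "z \<in> m\<^sub>1"
  have yz: "bracket z y \<in> m\<^sub>1" using y z m0_m2 by (intro bracket_m1_m2) auto
  moreover have "\<chi>\<^sub>1 (bracket z y) = 0"
    using \<chi>2_eq[OF yz] \<chi>2_bracket[of z y] y z m0_m2 m1_m2 by auto
  ultimately show "uea_incl z * uea_incl y - uea_incl y * uea_incl z \<in> H1.I"
    using H1.generator_I[OF yz] by (simp add: H1_generator shifted_def flip: uea_incl_bracket)
qed

section \<open>The second reduction, computed with representatives\<close>

abbreviation A1 where "A1 \<equiv> H1.H"

abbreviation cls1 :: "'g uea \<Rightarrow> 'g uea set" where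
  "cls1 a \<equiv> H1.I +>\<^bsub>uea_algebra\<^esub> a"

lemma cls1_eq_iff: "cls1 a = cls1 b \<longleftrightarrow> a - b \<in> H1.I"
  using H1.coset_eq_iff[of a b] by simp

lemma carrier_A1: "carrier A1 = cls1 ` H1.N"
  by (rule H1.carrier_H)

lemma A1_ops:
  "\<one>\<^bsub>A1\<^esub> = cls1 1" "\<zero>\<^bsub>A1\<^esub> = cls1 0" "cls1 a \<oplus>\<^bsub>A1\<^esub> cls1 b = cls1 (a + b)"
  "c \<odot>\<^bsub>A1\<^esub> cls1 a = cls1 (c *\<^sub>C a)"
  "b \<in> H1.N \<Longrightarrow> cls1 a \<otimes>\<^bsub>A1\<^esub> cls1 b = cls1 (a * b)"
  "a \<in> H1.N \<Longrightarrow> b \<in> H1.N \<Longrightarrow> cls1 a \<ominus>\<^bsub>A1\<^esub> cls1 b = cls1 (a - b)"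
  using H1.H_one H1.H_zero H1.H_add[of a b] H1.H_smult[of a c] H1.H_mult[of a b] H1.H_minus[of a b]
  by simp_all

lemma N1_closed: "1 \<in> H1.N" "0 \<in> H1.N" "a \<in> H1.N \<Longrightarrow> b \<in> H1.N \<Longrightarrow> a + b \<in> H1.N"
  "a \<in> H1.N \<Longrightarrow> b \<in> H1.N \<Longrightarrow> a * b \<in> H1.N" "a \<in> H1.N \<Longrightarrow> c *\<^sub>C a \<in> H1.N"
  using H1.N_one H1.N_zero H1.N_add[of a b] H1.N_mult[of a b] H1.N_smult[of a c] by auto

lemma N1_diff: "a \<in> H1.N \<Longrightarrow> b \<in> H1.N \<Longrightarrow> a - b \<in> H1.N"
  using N1_closed(3)[of a "(-1) *\<^sub>C b"] N1_closed(5)[of b "-1"] by simp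

lemma N2_diff: "a \<in> H2.N \<Longrightarrow> b \<in> H2.N \<Longrightarrow> a - b \<in> H2.N"
  using H2.N_add[of a "(-1) *\<^sub>C b"] H2.N_smult[of b "-1"] by simp

lemma shifted_m0_N1: "y \<in> m\<^sub>0 \<Longrightarrow> shifted \<chi>\<^sub>2 y \<in> H1.N"
  unfolding shifted_def by (intro N1_diff N1_closed incl_m0_N1)

lemma A1_generator:
  "y \<in> m\<^sub>0 \<Longrightarrow> cls1 (uea_incl y) \<ominus>\<^bsub>A1\<^esub> (\<chi>\<^sub>2 y \<odot>\<^bsub>A1\<^esub> \<one>\<^bsub>A1\<^esub>) = cls1 (shifted \<chi>\<^sub>2 y)"
  by (simp add: A1_ops incl_m0_N1 N1_closed shifted_def)

abbreviation I0 where
  "I0 \<equiv> shift_ideal A1 (\<lambda>y. cls1 (uea_incl y)) m\<^sub>0 \<chi>\<^sub>2"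

sublocale H0: hamiltonian A1 "\<lambda>y. cls1 (uea_incl y)" m\<^sub>0 \<chi>\<^sub>2
proof
  fix y z assume yz: "y \<in> m\<^sub>0" "z \<in> m\<^sub>0"
  then have b: "bracket y z \<in> m\<^sub>0" using m0 by (simp add: lie_subalgebra_def)
  let ?gen = "\<lambda>y. cls1 (uea_incl y) \<ominus>\<^bsub>A1\<^esub> (\<chi>\<^sub>2 y \<odot>\<^bsub>A1\<^esub> \<one>\<^bsub>A1\<^esub>)"
  have "?gen ` m\<^sub>0 \<subseteq> I0"
    unfolding shift_ideal_def[of A1]
    using H1.complex_algebra_H
    by (intro left_ideal_gen(2)) (auto simp: complex_algebra_def A1_generator carrier_A1 shifted_m0_N1)
  then have "cls1 (shifted \<chi>\<^sub>2 (bracket y z)) \<in> I0"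
    using b A1_generator[OF b] by blast
  moreover have "\<chi>\<^sub>2 (bracket y z) = 0"
    using yz m0_m2 by (intro \<chi>2_bracket) auto
  ultimately show "cls1 (uea_incl y) \<otimes>\<^bsub>A1\<^esub> cls1 (uea_incl z) \<ominus>\<^bsub>A1\<^esub> cls1 (uea_incl z) \<otimes>\<^bsub>A1\<^esub> cls1 (uea_incl y) \<in> I0"
    using yz by (simp add: A1_ops incl_m0_N1 N1_closed shifted_def uea_incl_bracket)
qed (auto simp: H1.complex_algebra_H carrier_A1 incl_m0_N1)

lemma H0_generator: "y \<in> m\<^sub>0 \<Longrightarrow> H0.generator y = cls1 (shifted \<chi>\<^sub>2 y)"
  unfolding H0.generator_def by (rule A1_generator)

text \<open>The preimage of the ideal of the second stage, so that one can work in the enveloping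
  algebra instead of with cosets of cosets.\<close>

definition J0 :: "'g uea set" where
  "J0 = {a \<in> H1.N. cls1 a \<in> I0}"

lemma J0_N1: "J0 \<subseteq> H1.N"
  by (auto simp: J0_def)

lemma J0_zero: "0 \<in> J0"
  using H0.I.zero_closed by (simp add: J0_def N1_closed A1_ops)

lemma J0_add: "a \<in> J0 \<Longrightarrow> b \<in> J0 \<Longrightarrow> a + b \<in> J0"
  using H0.I.a_closed[of "cls1 a" "cls1 b"] by (auto simp: J0_def A1_ops N1_closed)

lemma J0_mult: "a \<in> H1.N \<Longrightarrow> b \<in> J0 \<Longrightarrow> a * b \<in> J0"
  using H0.I_mult[of "cls1 a" "cls1 b"] by (auto simp: J0_def A1_ops N1_closed carrier_A1)

lemma I1_J0: "H1.I \<subseteq> J0"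
proof
  fix a assume a: "a \<in> H1.I"
  then have "cls1 a = cls1 0" by (simp add: cls1_eq_iff)
  then show "a \<in> J0" using J0_zero H1.I_subset_N a by (auto simp: J0_def)
qed

lemma shifted_J0: "y \<in> m\<^sub>0 \<Longrightarrow> shifted \<chi>\<^sub>2 y \<in> J0"
  using H0.generator_I[of y] by (simp add: J0_def H0_generator shifted_m0_N1)

text \<open>The classes of elements of \<open>H1.N \<inter> H2.I\<close> form a left ideal of
  \<open>A1\<close> containing the generators of \<open>I0\<close>, so minimality applies.\<close>

lemma J0_I2: "J0 \<subseteq> H2.I"
proof
  let ?K = "cls1 ` (H1.N \<inter> H2.I)"
  have "I0 \<subseteq> ?K"
  proof (rule H0.I_minimal)
    show "left_ideal ?K A1"
    proof (rule H0.left_idealI)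
      show "\<zero>\<^bsub>A1\<^esub> \<in> ?K" using N1_closed(2) I2_zero by (auto simp: A1_ops)
    qed (auto simp: carrier_A1 A1_ops intro!: imageI N1_closed I2_add I2_mult)
    fix y assume y: "y \<in> m\<^sub>0"
    then have "shifted \<chi>\<^sub>2 y \<in> H2.I"
      using H2.generator_I[of y] m0_m2 by (auto simp: H2_generator)
    then show "H0.generator y \<in> ?K" using y by (simp add: H0_generator shifted_m0_N1)
  qed
  moreover fix a assume "a \<in> J0"
  ultimately obtain b where "cls1 a = cls1 b" "b \<in> H2.I" by (auto simp: J0_def)
  then have "a - b \<in> H2.I" using I1_I2 by (auto simp: cls1_eq_iff)
  then show "a \<in> H2.I" using I2_add[of "a - b" b] \<open>b \<in> H2.I\<close> by simp
qed

lemma one_whittaker: "1 \<in> K1.whittaker"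
  using N1_closed by (simp add: whittaker_eq_N1)

text \<open>Write a product with \<open>raise c w\<close> as \<open>(a * raise c 1) * w\<close> and
  expand the first factor over \<open>H1.N\<close>. Right multiplication by \<open>w\<close> moves
  the coefficients into \<open>J0\<close> and preserves \<open>H1.I\<close>, because
  \<open>w\<close> lies in \<open>H1.N\<close>.\<close>

lemma expansions_J0_mult: "p \<in> K1.expansions J0 \<Longrightarrow> a * p \<in> K1.expansions J0"
proof (induction rule: K1.expansions_induct)
  case (ideal i)
  then show ?case by (intro K1.expansions_I J0_zero I1_mult)
next
  case (raise c w)
  have "a * raise c 1 \<in> K1.expansions H1.N"
    using K1.mem_expansions[OF one_whittaker] by (simp add: whittaker_eq_N1)
  then have "a * raise c 1 * w \<in> K1.expansions J0"
  proof (induction rule: K1.expansions_induct)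
    case (ideal i)
    then show ?case
      using raise J0_N1 H1.I_mult_N[of i w] by (intro K1.expansions_I J0_zero) auto
  next
    case (raise b v)
    then show ?case
      using \<open>w \<in> J0\<close> by (auto simp flip: raise_mult intro!: K1.expansions_raise J0_mult J0_zero)
  qed (auto simp: distrib_right intro: K1.expansions_add J0_add)
  then show ?case by (simp add: raise_eq_mult[of c w] mult.assoc)
qed (auto simp: distrib_left intro: K1.expansions_add J0_add)

text \<open>A generator of the second ideal splits along m2 = m1 + m0 into a generator of the first
  ideal and a constant term in \<open>J0\<close>.\<close>

lemma I2_expansions: "H2.I \<subseteq> K1.expansions J0"
proof (rule H2.I_minimal)
  show "left_ideal (K1.expansions J0) uea_algebra"
    by (rule H1.left_idealI)
      (auto intro: K1.expansions_I J0_zero I1_zero K1.expansions_add J0_add expansions_J0_mult)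
  fix y assume "y \<in> m\<^sub>2"
  then obtain y1 y0 where y: "y = y1 + y0" "y1 \<in> m\<^sub>1" "y0 \<in> m\<^sub>0" using m2_eq by blast
  have "H2.generator y = shifted \<chi>\<^sub>1 y1 + raise [] (shifted \<chi>\<^sub>2 y0)"
    using \<chi>2_eq[OF y(2)]
    by (simp add: H2_generator shifted_def y(1) uea_incl_add \<chi>2_add scaleC_add_left)
  also have "\<dots> \<in> K1.expansions J0"
    using H1.generator_I[OF y(2)] shifted_J0[OF y(3)]
    by (intro K1.expansions_add J0_add K1.expansions_I K1.expansions_raise J0_zero Nil_monomials)
      (simp_all add: H1_generator)
  finally show "H2.generator y \<in> K1.expansions J0" .
qed

text \<open>Injectivity: modulo the first ideal the element equals its constant term, and that term
  can be taken in \<open>J0\<close>.\<close>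

lemma N1_I2_subset_J0: "H1.N \<inter> H2.I \<subseteq> J0"
proof
  fix p assume p: "p \<in> H1.N \<inter> H2.I"
  then have "p \<in> K1.expansions J0" using I2_expansions by auto
  then obtain S w where S: "finite S" "S \<subseteq> monomials" "range w \<subseteq> J0" "\<forall>c. c \<notin> S \<longrightarrow> w c = 0"
      "p - (\<Sum>c\<in>S. raise c (w c)) \<in> H1.I"
    unfolding K1.expansions_def by blast
  have "p - w [] \<in> H1.I"
    using p S J0_N1 by (intro K1.expansion_constant_term) (auto simp: whittaker_eq_N1)
  then have "(p - w []) + w [] \<in> J0"
    using I1_J0 S(3) by (intro J0_add) auto
  then show "p \<in> J0" by simp
qed

text \<open>Surjectivity: expand over \<open>H1.N\<close> modulo the first ideal, then use
  independence modulo the second ideal to keep only the constant term.\<close>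

lemma N2_representative: "p \<in> H2.N \<Longrightarrow> \<exists>w\<in>H1.N. p - w \<in> H2.I"
proof -
  assume p: "p \<in> H2.N"
  have "p \<in> K1.expansions H1.N"
    using K1.mem_expansions[OF one_whittaker] by (simp add: whittaker_eq_N1)
  then obtain S w where S: "finite S" "S \<subseteq> monomials" "range w \<subseteq> H1.N" "\<forall>c. c \<notin> S \<longrightarrow> w c = 0"
      "p - (\<Sum>c\<in>S. raise c (w c)) \<in> H1.I"
    unfolding K1.expansions_def by blast
  have "p - w [] \<in> H2.I"
    using p S N2_whittaker2 N1_whittaker2 I1_I2 by (intro K2.expansion_constant_term) auto
  then show ?thesis using S(3) by auto
qed

definition N0 :: "'g uea set" where
  "N0 = {a \<in> H1.N. \<forall>y\<in>m\<^sub>0. uea_incl y * a - a * uea_incl y \<in> J0}"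

lemma N0_N1: "N0 \<subseteq> H1.N"
  by (auto simp: N0_def)

lemma H0_N_iff: "a \<in> H1.N \<Longrightarrow> cls1 a \<in> H0.N \<longleftrightarrow> a \<in> N0"
  by (auto simp: H0.N_def N0_def H0.ad_def J0_def carrier_A1 A1_ops N1_closed N1_diff incl_m0_N1)

lemma N0_N2: "N0 \<subseteq> H2.N"
proof
  fix a assume a: "a \<in> N0"
  show "a \<in> H2.N"
    unfolding N2_iff
  proof
    fix y assume "y \<in> m\<^sub>2"
    then obtain y1 y0 where y: "y = y1 + y0" "y1 \<in> m\<^sub>1" "y0 \<in> m\<^sub>0" using m2_eq by blast
    have "uea_incl y * a - a * uea_incl y =
        (uea_incl y1 * a - a * uea_incl y1) + (uea_incl y0 * a - a * uea_incl y0)"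
      by (simp add: y(1) uea_incl_add algebra_simps)
    also have "\<dots> \<in> H2.I"
      using a y I1_I2 J0_I2 by (intro I2_add) (auto simp: N0_def N1_iff)
    finally show "uea_incl y * a - a * uea_incl y \<in> H2.I" .
  qed
qed

text \<open>For \<open>a\<close> invariant in both senses, its commutators with
  \<open>m\<^sub>0\<close> lie in \<open>H1.N\<close> and in \<open>H2.I\<close>, hence in
  \<open>J0\<close> by the injectivity step.\<close>

lemma N0_eq: "N0 = H1.N \<inter> H2.N"
proof
  show "H1.N \<inter> H2.N \<subseteq> N0"
    unfolding N0_def using m0_m2
    by (auto simp: N2_iff intro!: subsetD[OF N1_I2_subset_J0] N1_diff N1_closed incl_m0_N1)
qed (use N0_N1 N0_N2 in auto)

section \<open>Identification of the two reductions\<close>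

abbreviation A0 where "A0 \<equiv> H0.H"

abbreviation A2 where "A2 \<equiv> H2.H"

abbreviation cls0 :: "'g uea \<Rightarrow> 'g uea set set" where
  "cls0 a \<equiv> I0 +>\<^bsub>A1\<^esub> cls1 a"

abbreviation cls2 :: "'g uea \<Rightarrow> 'g uea set" where
  "cls2 a \<equiv> H2.I +>\<^bsub>uea_algebra\<^esub> a"

lemma cls2_eq_iff: "cls2 a = cls2 b \<longleftrightarrow> a - b \<in> H2.I"
  using H2.coset_eq_iff[of a b] by simp

text \<open>On \<open>H1.N\<close> the two-stage quotient and the quotient by \<open>H2.I\<close>
  identify the same elements; this gives both well-definedness and injectivity of the map.\<close>

lemma cls0_eq_iff:
  assumes "a \<in> H1.N" "b \<in> H1.N"
  shows "cls0 a = cls0 b \<longleftrightarrow> a - b \<in> H2.I"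
proof -
  have "cls0 a = cls0 b \<longleftrightarrow> a - b \<in> J0"
    using H0.coset_eq_iff[of "cls1 a" "cls1 b"] assms by (auto simp: carrier_A1 A1_ops J0_def N1_diff)
  then show ?thesis using N1_I2_subset_J0 J0_I2 N1_diff[OF assms] by auto
qed

lemma carrier_A0: "carrier A0 = cls0 ` N0"
proof -
  have "H0.N = cls1 ` N0"
    using H0_N_iff H0.N_closed N0_N1 by (fastforce simp: carrier_A1)
  then show ?thesis by (simp add: H0.carrier_H image_image)
qed

lemma carrier_A2: "carrier A2 = cls2 ` N0"
proof -
  have "cls2 p \<in> cls2 ` N0" if p: "p \<in> H2.N" for p
  proof -
    obtain w where w: "w \<in> H1.N" "p - w \<in> H2.I" using N2_representative[OF p] by blast
    \<comment> \<open>This difference is \<open>w\<close>, so changing the representative within the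
      second ideal keeps it invariant under \<open>m\<^sub>2\<close>.\<close>
    have "p - (p - w) \<in> H2.N" by (rule N2_diff[OF p]) (use w H2.I_subset_N in auto)
    then have "w \<in> N0" using w by (simp add: N0_eq)
    then show ?thesis using w cls2_eq_iff by auto
  qed
  then show ?thesis using N0_N2 by (auto simp: H2.carrier_H)
qed

lemma A0_ops:
  assumes "a \<in> N0" "b \<in> N0"
  shows "cls0 a \<oplus>\<^bsub>A0\<^esub> cls0 b = cls0 (a + b)" "cls0 a \<otimes>\<^bsub>A0\<^esub> cls0 b = cls0 (a * b)"
    "c \<odot>\<^bsub>A0\<^esub> cls0 a = cls0 (c *\<^sub>C a)"
proof -
  have "cls1 a \<in> carrier A1" "cls1 b \<in> carrier A1" "cls1 b \<in> H0.N" "b \<in> H1.N"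
    using assms N0_N1 H0_N_iff by (auto simp: carrier_A1)
  then show "cls0 a \<oplus>\<^bsub>A0\<^esub> cls0 b = cls0 (a + b)" "cls0 a \<otimes>\<^bsub>A0\<^esub> cls0 b = cls0 (a * b)"
    "c \<odot>\<^bsub>A0\<^esub> cls0 a = cls0 (c *\<^sub>C a)"
    by (simp_all add: H0.H_add H0.H_mult H0.H_smult A1_ops)
qed

lemma A2_ops:
  assumes "a \<in> N0" "b \<in> N0"
  shows "cls2 a \<oplus>\<^bsub>A2\<^esub> cls2 b = cls2 (a + b)" "cls2 a \<otimes>\<^bsub>A2\<^esub> cls2 b = cls2 (a * b)"
    "c \<odot>\<^bsub>A2\<^esub> cls2 a = cls2 (c *\<^sub>C a)"
  using H2.H_add[of a b] H2.H_mult[of a b] H2.H_smult[of a c] assms N0_N2 by auto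

lemma N0_closed: "a \<in> N0 \<Longrightarrow> b \<in> N0 \<Longrightarrow> a + b \<in> N0" "a \<in> N0 \<Longrightarrow> b \<in> N0 \<Longrightarrow> a * b \<in> N0"
  "a \<in> N0 \<Longrightarrow> c *\<^sub>C a \<in> N0" "1 \<in> N0"
  using H2.N_add[of a b] H2.N_mult[of a b] H2.N_smult[of a c] H2.N_one
  by (simp_all add: N0_eq N1_closed)

theorem reduction_by_stages:
  "\<exists>\<Psi>\<in>algebra_iso A0 A2. \<forall>a. cls1 a \<in> carrier A1 \<longrightarrow> cls0 a \<in> carrier A0 \<longrightarrow> \<Psi> (cls0 a) = cls2 a"
proof -
  \<comment> \<open>The chosen representative does not matter, because equality of two-stage classes
    implies equality modulo the second ideal.\<close>
  define \<Psi> where "\<Psi> C = cls2 (SOME a. a \<in> N0 \<and> C = cls0 a)" for C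
  have \<Psi>: "\<Psi> (cls0 a) = cls2 a" if a: "a \<in> N0" for a
  proof -
    define b where "b = (SOME b. b \<in> N0 \<and> cls0 a = cls0 b)"
    have "b \<in> N0 \<and> cls0 a = cls0 b"
      unfolding b_def by (rule someI_ex) (use a in blast)
    then have "cls2 a = cls2 b" using a N0_N1 cls0_eq_iff[of a b] cls2_eq_iff by auto
    then show ?thesis by (simp add: \<Psi>_def b_def)
  qed
  have bij: "bij_betw \<Psi> (carrier A0) (carrier A2)"
    unfolding bij_betw_def
  proof
    show "inj_on \<Psi> (carrier A0)"
    proof (rule inj_onI)
      fix C D assume "C \<in> carrier A0" "D \<in> carrier A0" and eq: "\<Psi> C = \<Psi> D"
      then obtain a b where a: "a \<in> N0" "C = cls0 a" and b: "b \<in> N0" "D = cls0 b"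
        unfolding carrier_A0 by blast
      then show "C = D"
        using eq N0_N1 cls0_eq_iff[of a b] cls2_eq_iff[of a b] by (auto simp: \<Psi>)
    qed
    show "\<Psi> ` carrier A0 = carrier A2"
      unfolding carrier_A0 carrier_A2 image_image using \<Psi> by (intro image_cong) auto
  qed
  have one: "\<one>\<^bsub>A0\<^esub> = cls0 1" "\<one>\<^bsub>A2\<^esub> = cls2 1"
    using H0.H_one H2.H_one by (simp_all add: A1_ops)
  have "\<Psi> \<in> ring_hom A0 A2"
    by (rule ring_hom_memI) (auto simp: carrier_A0 carrier_A2 A0_ops A2_ops N0_closed \<Psi> one)
  then have "\<Psi> \<in> algebra_iso A0 A2"
    using bij H0.complex_algebra_H H2.complex_algebra_H
    by (auto simp: algebra_iso_def ring_iso_def carrier_A0 A0_ops A2_ops N0_closed \<Psi>)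
  \<comment> \<open>The formula is claimed for every \<open>a\<close> whose classes lie in the
    carriers; it is compared with representatives in \<open>H1.N\<close> and in \<open>N0\<close>,
    both differing from it by the second ideal.\<close>
  moreover have "\<Psi> (cls0 a) = cls2 a" if a1: "cls1 a \<in> carrier A1" and a0: "cls0 a \<in> carrier A0" for a
  proof -
    obtain b where b: "b \<in> N0" "cls0 a = cls0 b" using a0 by (auto simp: carrier_A0)
    obtain a' where a': "a' \<in> H1.N" "cls1 a = cls1 a'" using a1 by (auto simp: carrier_A1)
    have "a' - b \<in> H2.I" using a' b N0_N1 cls0_eq_iff[of a' b] by auto
    moreover have "a - a' \<in> H2.I" using a'(2) I1_I2 by (auto simp: cls1_eq_iff)
    ultimately have "(a - a') + (a' - b) \<in> H2.I" by (intro I2_add)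
    then have "cls2 a = cls2 b" by (simp add: cls2_eq_iff)
    then show ?thesis using \<Psi>[OF b(1)] b(2) by simp
  qed
  ultimately show ?thesis by blast
qed

end

section \<open>From good gradings to the reduction by stages\<close>

theorem theorem3:
  fixes \<beta> :: "'g::complex_lie_algebra \<Rightarrow> 'g \<Rightarrow> complex"
    and f\<^sub>1 f\<^sub>2 q\<^sub>1 q\<^sub>2 :: 'g
    and \<Gamma>\<^sub>1 \<Gamma>\<^sub>2 :: "int \<Rightarrow> 'g set"
    and h m\<^sub>0 m\<^sub>1 m\<^sub>2 :: "'g set"
  assumes "finite_dimensional TYPE('g)" and "simple_lie_algebra TYPE('g)"
    and "invariant_form \<beta>"
    and "nilpotent_element f\<^sub>1" and "nilpotent_element f\<^sub>2"
    and "good_grading f\<^sub>1 \<Gamma>\<^sub>1" and "good_grading f\<^sub>2 \<Gamma>\<^sub>2"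
    and "grading_element q\<^sub>1 \<Gamma>\<^sub>1" and "grading_element q\<^sub>2 \<Gamma>\<^sub>2"
    and "cartan_subalgebra h" and "q\<^sub>1 \<in> h" and "q\<^sub>2 \<in> h"
    and "good_algebra \<beta> f\<^sub>1 \<Gamma>\<^sub>1 m\<^sub>1" and "good_algebra \<beta> f\<^sub>2 \<Gamma>\<^sub>2 m\<^sub>2"
    and "lie_subalgebra m\<^sub>0" and "m\<^sub>0 \<subseteq> m\<^sub>2" and "\<forall>x\<in>h. \<forall>y\<in>m\<^sub>0. bracket x y \<in> m\<^sub>0"
    and "lie_ideal_in m\<^sub>1 m\<^sub>2"
    and "m\<^sub>2 = {x + y | x y. x \<in> m\<^sub>1 \<and> y \<in> m\<^sub>0}" and "m\<^sub>1 \<inter> m\<^sub>0 = {0}"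
    and "nilpotent_element (f\<^sub>2 - f\<^sub>1)" and "f\<^sub>2 - f\<^sub>1 \<in> \<Gamma>\<^sub>1 0" and "m\<^sub>0 \<subseteq> \<Gamma>\<^sub>1 0"
    and "semisimple_element (q\<^sub>2 - q\<^sub>1)" and "bracket (q\<^sub>2 - q\<^sub>1) f\<^sub>1 = 0"
  shows "\<exists>\<Psi> \<in> algebra_iso (stage_algebra \<beta> f\<^sub>1 m\<^sub>1 f\<^sub>2 m\<^sub>0) (W_algebra \<beta> f\<^sub>2 m\<^sub>2).
    \<forall>u. W_class \<beta> f\<^sub>1 m\<^sub>1 u \<in> carrier (W_algebra \<beta> f\<^sub>1 m\<^sub>1) \<longrightarrow>
        stage_class \<beta> f\<^sub>1 m\<^sub>1 f\<^sub>2 m\<^sub>0 (W_class \<beta> f\<^sub>1 m\<^sub>1 u) \<in> carrier (stage_algebra \<beta> f\<^sub>1 m\<^sub>1 f\<^sub>2 m\<^sub>0) \<longrightarrow>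
        \<Psi> (stage_class \<beta> f\<^sub>1 m\<^sub>1 f\<^sub>2 m\<^sub>0 (W_class \<beta> f\<^sub>1 m\<^sub>1 u)) = W_class \<beta> f\<^sub>2 m\<^sub>2 u"
proof -
  interpret G1: graded_form \<beta> f\<^sub>1 q\<^sub>1 \<Gamma>\<^sub>1
    by standard fact+
  interpret G2: graded_form \<beta> f\<^sub>2 q\<^sub>2 \<Gamma>\<^sub>2
    by standard fact+
  obtain r x u d where "dual_bases (\<beta> f\<^sub>1) \<Gamma>\<^sub>1 r x u d"
    and m1: "m\<^sub>1 = complex_vector.span (x ` {..<r})"
    using G1.exists_dual_bases[OF \<open>good_algebra \<beta> f\<^sub>1 \<Gamma>\<^sub>1 m\<^sub>1\<close>] by blast
  then interpret dual_bases "\<beta> f\<^sub>1" \<Gamma>\<^sub>1 r x u d by simp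
  interpret two_stages "\<beta> f\<^sub>1" \<Gamma>\<^sub>1 r x u d "\<beta> f\<^sub>2" m\<^sub>0 m\<^sub>1 m\<^sub>2
  proof
    fix y assume "y \<in> m\<^sub>1"
    \<comment> \<open>The difference has degree 0 and \<open>m\<^sub>1\<close> is spanned by
      elements of positive degree, so they are orthogonal. Hence both characters agree on
      \<open>m\<^sub>1\<close>.\<close>
    then have "\<beta> (f\<^sub>2 - f\<^sub>1) y = 0"
      unfolding m1
    proof (induction rule: complex_vector.span_induct_alt)
      case (step c z y)
      then obtain i where "i < r" "z = x i" by auto
      then have "\<beta> (f\<^sub>2 - f\<^sub>1) z = 0"
        using G1.\<beta>_orthogonal[OF \<open>f\<^sub>2 - f\<^sub>1 \<in> \<Gamma>\<^sub>1 0\<close> x_\<Gamma>, of i] d_pos[of i] by simp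
      then show ?case using step by (simp add: G1.\<beta>_add G1.\<beta>_scale)
    qed (simp add: G1.\<beta>_zero)
    then show "\<beta> f\<^sub>2 y = \<beta> f\<^sub>1 y"
      using G1.\<beta>_add(1)[of "f\<^sub>2 - f\<^sub>1" f\<^sub>1 y] by simp
  next
    fix y z assume "y \<in> m\<^sub>2" "z \<in> m\<^sub>2"
    then show "\<beta> f\<^sub>2 (bracket y z) = 0"
      by (rule G2.good_algebra_character[OF \<open>good_algebra \<beta> f\<^sub>2 \<Gamma>\<^sub>2 m\<^sub>2\<close>])
  qed (fact m1 G1.\<beta>_add assms)+
  show ?thesis
    using reduction_by_stages
    unfolding stage_algebra_def stage_class_def stage_ideal_def W_algebra_def W_class_def W_ideal_def .
qed

end
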